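(* Let $H(\mathbb{C})$ be the space of entire functions with the topology of uniform convergence on compact sets, and let $H'(\mathbb{C})=\bigcup_{p\in\mathbb{N}}\mathbf{H}_2(2^{-p}\mathbb{D})$ be its strong dual (the space of germs of holomorphic functions at zero), with the product of power series. The following properties hold: (a) The multiplication is continuous, i.e. $(H'(\mathbb{C}),+,\cdot)$ is a topological algebra. (b) The set $GL(H'(\mathbb{C}))$ of invertible elements is open and the function $f\mapsto f^{-1}$ is continuous. (c) $f\in H'(\mathbb{C})$ is invertible if and only if $f(0)\ne0$. (d) $H'(\mathbb{C})$ is nuclear.
   Context: $\mathbb D$ is the open unit disk. For an integer $p$, $\mathbf H_2(2^{p}\mathbb D)=\{\sum_{n\ge0}a_nz^n:\sum_{n\ge0}|a_n|^2 2^{2np}<\infty\}$ with norm $\|\sum a_nz^n\|_p^2=\sum_n|a_n|^2 2^{2np}$. One has $H(\mathbb C)=\bigcap_{p\in\mathbb N}\mathbf H_2(2^p\mathbb D)$ as a countably Hilbert (Fréchet) space. The dual $H'(\mathbb C)$, with the strong dual topology, is written as $\bigcup_{p\in\mathbb N}\mathbf H_2(2^{-p}\mathbb D)$, an element $\sum b_nz^n$ acting on $\sum a_nz^n\in H(\mathbb C)$ through the coefficient pairing $\sum_n a_nb_n$; $\mathbf H_2(2^{-p}\mathbb D)$ is the dual of $\mathbf H_2(2^p\mathbb D)$. The strong topology coincides with the locally convex inductive limit topology of the Hilbert spaces $\mathbf H_2(2^{-p}\mathbb D)$. The product of $f(z)=\sum a_nz^n$ and $g(z)=\sum b_nz^n$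 is $(fg)(z)=\sum_n\big(\sum_{m=0}^na_mb_{n-m}\big)z^n$. *)

theory Defs
  imports "HOL-Complex_Analysis.Complex_Analysis"
begin

section \<open>Topological vector spaces with an explicit carrier\<close>

text \<open>
  A topological vector space is given by a scalar multiplication \<open>s\<close> on an ambient abelian group
  and an abstract topology \<open>T\<close>; the space itself is \<open>topspace T\<close>. The type class topology
  of \<^typ>\<open>complex fps\<close> (coefficientwise with discrete coefficients) plays no role below.
\<close>

definition topological_vector_space ::
    "(complex \<Rightarrow> 'a::ab_group_add \<Rightarrow> 'a) \<Rightarrow> 'a topology \<Rightarrow> bool" where
  "topological_vector_space s T \<longleftrightarrow>
     vector_space s \<and> module.subspace s (topspace T) \<and>
     continuous_map (prod_topology T T) T (\<lambda>(x, y). x + y) \<and>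
     continuous_map (prod_topology euclidean T) T (\<lambda>(c, x). s c x)"

definition topological_algebra ::
    "(complex \<Rightarrow> 'a::ring \<Rightarrow> 'a) \<Rightarrow> 'a topology \<Rightarrow> bool" where
  "topological_algebra s T \<longleftrightarrow>
     topological_vector_space s T \<and>
     (\<forall>c. \<forall>x\<in>topspace T. \<forall>y\<in>topspace T. s c x * y = s c (x * y) \<and> x * s c y = s c (x * y)) \<and>
     continuous_map (prod_topology T T) T (\<lambda>(x, y). x * y)"

definition convex_wrt :: "(complex \<Rightarrow> 'a::ab_group_add \<Rightarrow> 'a) \<Rightarrow> 'a set \<Rightarrow> bool" where
  "convex_wrt s W \<longleftrightarrow>
     (\<forall>x\<in>W. \<forall>y\<in>W. \<forall>t\<in>{0..1::real}. s (of_real t) x + s (of_real (1 - t)) y \<in> W)"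

definition locally_convex_space ::
    "(complex \<Rightarrow> 'a::ab_group_add \<Rightarrow> 'a) \<Rightarrow> 'a topology \<Rightarrow> bool" where
  "locally_convex_space s T \<longleftrightarrow>
     topological_vector_space s T \<and>
     (\<forall>U. openin T U \<and> 0 \<in> U \<longrightarrow> (\<exists>W. openin T W \<and> 0 \<in> W \<and> convex_wrt s W \<and> W \<subseteq> U))"

definition continuous_seminorm ::
    "(complex \<Rightarrow> 'a::ab_group_add \<Rightarrow> 'a) \<Rightarrow> 'a topology \<Rightarrow> ('a \<Rightarrow> real) \<Rightarrow> bool" where
  "continuous_seminorm s T p \<longleftrightarrow>
     (\<forall>x\<in>topspace T. 0 \<le> p x) \<and>
     (\<forall>x\<in>topspace T. \<forall>y\<in>topspace T. p (x + y) \<le> p x + p y) \<and>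
     (\<forall>c. \<forall>x\<in>topspace T. p (s c x) = norm c * p x) \<and>
     continuous_map T euclideanreal p"


section \<open>Nuclear spaces\<close>

text \<open>
  For a seminorm \<open>p\<close> on \<open>V\<close>, let \<open>V\<^sub>p\<close> be the Banach space obtained by completing
  \<open>V / {x. p x = 0}\<close> in the norm induced by \<open>p\<close>. Points of \<open>V\<^sub>p\<close> are represented by
  \<open>p\<close>-Cauchy sequences in \<open>V\<close>, with norm the limit of \<open>p\<close> along the sequence; the image
  of \<open>x \<in> V\<close> is represented by the constant sequence.
\<close>

definition completion_seqs :: "'a::ab_group_add set \<Rightarrow> ('a \<Rightarrow> real) \<Rightarrow> (nat \<Rightarrow> 'a) set" where
  "completion_seqs V p =
     {y. range y \<subseteq> V \<and> (\<forall>e>0. \<exists>M. \<forall>j\<ge>M. \<forall>k\<ge>M. p (y j - y k) < e)}"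

definition completion_norm :: "('a \<Rightarrow> real) \<Rightarrow> (nat \<Rightarrow> 'a) \<Rightarrow> real" where
  "completion_norm p y = lim (\<lambda>k. p (y k))"

text \<open>
  The functionals in the dual of \<open>V\<^sub>q\<close> correspond to the \<open>q\<close>-bounded linear functionals
  on \<open>V\<close>, with the same norm.
\<close>

definition bounded_functional ::
    "(complex \<Rightarrow> 'a::ab_group_add \<Rightarrow> 'a) \<Rightarrow> 'a set \<Rightarrow> ('a \<Rightarrow> real) \<Rightarrow> ('a \<Rightarrow> complex) \<Rightarrow> bool" where
  "bounded_functional s V q u \<longleftrightarrow>
     (\<forall>x\<in>V. \<forall>y\<in>V. u (x + y) = u x + u y) \<and>
     (\<forall>c. \<forall>x\<in>V. u (s c x) = c * u x) \<and>
     (\<exists>C. \<forall>x\<in>V. norm (u x) \<le> C * q x)"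

definition functional_norm :: "'a set \<Rightarrow> ('a \<Rightarrow> real) \<Rightarrow> ('a \<Rightarrow> complex) \<Rightarrow> real" where
  "functional_norm V q u = (SUP x\<in>{x \<in> V. q x \<le> 1}. norm (u x))"

text \<open>
  For \<open>p \<le> q\<close>, the canonical map \<open>V\<^sub>q \<rightarrow> V\<^sub>p\<close> is nuclear if it equals
  \<open>x \<mapsto> \<Sum>n. u\<^sub>n(x) y\<^sub>n\<close> with \<open>u\<^sub>n\<close> in the dual of \<open>V\<^sub>q\<close>,
  \<open>y\<^sub>n \<in> V\<^sub>p\<close> and summable \<open>\<parallel>u\<^sub>n\<parallel> \<parallel>y\<^sub>n\<parallel>\<close>. Both sides are continuous in \<open>x\<close>, so it is
  enough to require the equality on the dense image of \<open>V\<close>.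
\<close>

definition nuclear_canonical_map ::
    "(complex \<Rightarrow> 'a::ab_group_add \<Rightarrow> 'a) \<Rightarrow> 'a set \<Rightarrow> ('a \<Rightarrow> real) \<Rightarrow> ('a \<Rightarrow> real) \<Rightarrow> bool" where
  "nuclear_canonical_map s V q p \<longleftrightarrow>
     (\<exists>(u :: nat \<Rightarrow> 'a \<Rightarrow> complex) (y :: nat \<Rightarrow> nat \<Rightarrow> 'a).
        (\<forall>n. bounded_functional s V q (u n)) \<and>
        (\<forall>n. y n \<in> completion_seqs V p) \<and>
        summable (\<lambda>n. functional_norm V q (u n) * completion_norm p (y n)) \<and>
        (\<forall>x\<in>V. (\<lambda>N. completion_norm p (\<lambda>k. x - (\<Sum>n<N. s (u n x) (y n k)))) \<longlonglongrightarrow> 0))"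

definition nuclear_space ::
    "(complex \<Rightarrow> 'a::ab_group_add \<Rightarrow> 'a) \<Rightarrow> 'a topology \<Rightarrow> bool" where
  "nuclear_space s T \<longleftrightarrow>
     locally_convex_space s T \<and>
     (\<forall>p. continuous_seminorm s T p \<longrightarrow>
        (\<exists>q. continuous_seminorm s T q \<and> (\<forall>x\<in>topspace T. p x \<le> q x) \<and>
             nuclear_canonical_map s (topspace T) q p))"


section \<open>The space of entire functions\<close>

definition entire_functions :: "(complex \<Rightarrow> complex) set" where
  "entire_functions = {f. f holomorphic_on UNIV}"

definition entire_nhd ::
    "(complex \<Rightarrow> complex) \<Rightarrow> complex set \<Rightarrow> real \<Rightarrow> (complex \<Rightarrow> complex) set" where
  "entire_nhd f K e = {g \<in> entire_functions. \<forall>z\<in>K. norm (g z - f z) < e}"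

text \<open>The topology of uniform convergence on compact sets.\<close>

definition entire_topology :: "(complex \<Rightarrow> complex) topology" where
  "entire_topology = topology (\<lambda>U. U \<subseteq> entire_functions \<and>
     (\<forall>f\<in>U. \<exists>K e. compact K \<and> e > 0 \<and> entire_nhd f K e \<subseteq> U))"

lemma openin_entire_topology:
  "openin entire_topology U \<longleftrightarrow> U \<subseteq> entire_functions \<and>
     (\<forall>f\<in>U. \<exists>K e. compact K \<and> e > 0 \<and> entire_nhd f K e \<subseteq> U)"
proof -
  let ?P = "\<lambda>U. U \<subseteq> entire_functions \<and>
     (\<forall>f\<in>U. \<exists>K e. compact K \<and> e > 0 \<and> entire_nhd f K e \<subseteq> U)"
  have "?P (S \<inter> T)" if S: "?P S" and T: "?P T" for S T
  proof (intro conjI ballI)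
    fix f assume "f \<in> S \<inter> T"
    then obtain K e L d where "compact K" "e > 0" "entire_nhd f K e \<subseteq> S"
      "compact L" "d > 0" "entire_nhd f L d \<subseteq> T"
      using S T by (meson IntD1 IntD2)
    then show "\<exists>K e. compact K \<and> e > 0 \<and> entire_nhd f K e \<subseteq> S \<inter> T"
      by (intro exI[of _ "K \<union> L"] exI[of _ "min e d"]) (auto simp: entire_nhd_def)
  qed (use S in auto)
  moreover have "?P (\<Union>\<K>)" if \<K>: "\<forall>K\<in>\<K>. ?P K" for \<K>
  proof (intro conjI ballI)
    fix f assume "f \<in> \<Union>\<K>"
    then obtain S where S: "S \<in> \<K>" "f \<in> S" by blast
    then obtain K e where "compact K" "e > 0" "entire_nhd f K e \<subseteq> S"
      using bspec[OF \<K> S(1)] by meson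
    then show "\<exists>K e. compact K \<and> e > 0 \<and> entire_nhd f K e \<subseteq> \<Union>\<K>"
      using S by blast
  qed (use \<K> in blast)
  ultimately have "istopology ?P"
    unfolding istopology_def by simp
  then show ?thesis
    by (simp add: entire_topology_def topology_inverse')
qed

lemma openin_entire_functions:
  "openin entire_topology entire_functions"
  by (auto simp: openin_entire_topology entire_nhd_def intro!: exI[of _ "{}"] exI[of _ 1])

lemma topspace_entire_topology [simp]: "topspace entire_topology = entire_functions"
  using openin_entire_functions openin_entire_topology[of "topspace entire_topology"]
  by (meson openin_subset openin_topspace subset_antisym)

text \<open>Boundedness in the sense of topological vector spaces: absorption by every neighbourhood of \<open>0\<close>.\<close>

definition entire_bounded :: "(complex \<Rightarrow> complex) set \<Rightarrow> bool" where
  "entire_bounded B \<longleftrightarrow> B \<subseteq> entire_functions \<and>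
     (\<forall>U. openin entire_topology U \<and> (\<lambda>z. 0) \<in> U \<longrightarrow>
        (\<exists>r>0. \<forall>t\<ge>r::real. B \<subseteq> (\<lambda>f z. of_real t * f z) ` U))"

lemma entire_bounded_iff:
  "entire_bounded B \<longleftrightarrow> B \<subseteq> entire_functions \<and>
     (\<forall>K. compact K \<longrightarrow> (\<exists>M. \<forall>f\<in>B. \<forall>z\<in>K. norm (f z) \<le> M))"
proof (intro iffI conjI allI impI)
  assume B: "entire_bounded B"
  then show "B \<subseteq> entire_functions" by (simp add: entire_bounded_def)
  fix K :: "complex set" assume K: "compact K"
  define U where "U = {g \<in> entire_functions. \<exists>d<1. \<forall>z\<in>K. norm (g z) \<le> d}"
  have "openin entire_topology U"
    unfolding openin_entire_topology
  proof (intro conjI ballI)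
    fix f assume "f \<in> U"
    then obtain d where d: "d < 1" "\<forall>z\<in>K. norm (f z) \<le> d" by (auto simp: U_def)
    have "entire_nhd f K ((1 - d) / 2) \<subseteq> U"
    proof
      fix g assume g: "g \<in> entire_nhd f K ((1 - d) / 2)"
      have "norm (g z) \<le> (1 + d) / 2" if "z \<in> K" for z
      proof -
        have "norm (g z) \<le> norm (f z) + norm (g z - f z)"
          by (metis add.commute diff_add_cancel norm_triangle_ineq)
        also have "\<dots> \<le> d + (1 - d) / 2"
          using d(2) g that by (intro add_mono) (auto simp: entire_nhd_def less_imp_le)
        finally show ?thesis by (simp add: field_simps)
      qed
      then show "g \<in> U"
        using g d(1) by (auto simp: U_def entire_nhd_def intro!: exI[of _ "(1 + d) / 2"])
    qed
    then show "\<exists>K e. compact K \<and> e > 0 \<and> entire_nhd f K e \<subseteq> U"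
      using K d(1) by (intro exI[of _ K] exI[of _ "(1 - d) / 2"]) auto
  qed (auto simp: U_def)
  moreover have "(\<lambda>z. 0) \<in> U"
    by (auto simp: U_def entire_functions_def intro!: exI[of _ 0])
  ultimately obtain r where r: "r > 0" "\<forall>t\<ge>r::real. B \<subseteq> (\<lambda>f z. of_real t * f z) ` U"
    using B unfolding entire_bounded_def by meson
  have "norm (f z) \<le> r" if f: "f \<in> B" and z: "z \<in> K" for f z
  proof -
    obtain g where g: "g \<in> U" "f = (\<lambda>z. of_real r * g z)" using r f by blast
    have "norm (g z) \<le> 1" using g(1) z by (force simp: U_def)
    then show ?thesis using r(1) by (simp add: g(2) norm_mult mult_left_le)
  qed
  then show "\<exists>M. \<forall>f\<in>B. \<forall>z\<in>K. norm (f z) \<le> M" by blast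
next
  assume B: "B \<subseteq> entire_functions \<and>
     (\<forall>K. compact K \<longrightarrow> (\<exists>M. \<forall>f\<in>B. \<forall>z\<in>K. norm (f z) \<le> M))"
  show "entire_bounded B"
    unfolding entire_bounded_def
  proof (intro conjI allI impI)
    fix U assume U: "openin entire_topology U \<and> (\<lambda>z. 0) \<in> U"
    then obtain K e where K: "compact K" "e > 0" "entire_nhd (\<lambda>z. 0) K e \<subseteq> U"
      unfolding openin_entire_topology by meson
    obtain M where M: "\<forall>f\<in>B. \<forall>z\<in>K. norm (f z) \<le> M" using B K(1) by meson
    define r where "r = (\<bar>M\<bar> + 1) / e"
    have r: "r > 0" using K(2) by (simp add: r_def)
    have "f \<in> (\<lambda>f z. of_real t * f z) ` U" if t: "t \<ge> r" and f: "f \<in> B" for f and t :: real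
    proof (rule image_eqI)
      have t0: "t > 0" using r t by simp
      show "f = (\<lambda>z. of_real t * (f z / of_real t))" using t0 by simp
      have "norm (f z / of_real t) < e" if "z \<in> K" for z
      proof -
        have "norm (f z) \<le> M" using M f that by blast
        also have "M < r * e" using K(2) by (simp add: r_def)
        also have "\<dots> \<le> t * e" using t K(2) by simp
        finally show ?thesis using t0 by (simp add: norm_divide field_simps)
      qed
      moreover have "(\<lambda>z. f z / of_real t) \<in> entire_functions"
        using B f t0 by (auto simp: entire_functions_def intro!: holomorphic_intros)
      ultimately show "(\<lambda>z. f z / of_real t) \<in> U"
        using K(3) by (auto simp: entire_nhd_def)
    qed
    then show "\<exists>r>0. \<forall>t\<ge>r::real. B \<subseteq> (\<lambda>f z. of_real t * f z) ` U"
      using r by blast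
  qed (use B in simp)
qed


section \<open>The strong dual\<close>

text \<open>
  A power series is identified with its sequence of coefficients; the disk of radius \<open>2\<^sup>p\<close> enters
  through the weights only.
\<close>

definition H2 :: "int \<Rightarrow> complex fps set" where
  "H2 p = {b. summable (\<lambda>n. (norm (fps_nth b n))\<^sup>2 * 2 powi (2 * int n * p))}"

definition germs :: "complex fps set" where
  "germs = (\<Union>p::nat. H2 (- int p))"

definition germ_scale :: "complex \<Rightarrow> complex fps \<Rightarrow> complex fps" where
  "germ_scale c b = fps_const c * b"

definition dual_pairing :: "complex fps \<Rightarrow> (complex \<Rightarrow> complex) \<Rightarrow> complex" where
  "dual_pairing b f = (\<Sum>n. fps_nth (fps_expansion f 0) n * fps_nth b n)"

text \<open>
  Through the pairing, \<open>germs\<close> is exactly the space of continuous linear functionals on the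
  entire functions.
\<close>

lemma entire_coeff_bound:
  assumes "f \<in> entire_functions" "R > 0" "\<And>z. norm z \<le> R \<Longrightarrow> norm (f z) \<le> M"
  shows "norm (fps_nth (fps_expansion f 0) n) \<le> M / R ^ n"
proof -
  have hol: "f holomorphic_on A" for A
    using assms(1) holomorphic_on_subset by (auto simp: entire_functions_def)
  have "norm ((deriv ^^ n) f 0) \<le> fact n * M / R ^ n"
    by (rule Cauchy_inequality) (use assms hol in \<open>auto intro: holomorphic_on_imp_continuous_on\<close>)
  then show ?thesis
    by (simp add: fps_expansion_def norm_divide field_simps)
qed

lemma entire_sums:
  assumes "f \<in> entire_functions"
  shows "(\<lambda>n. fps_nth (fps_expansion f 0) n * z ^ n) sums f z"
proof -
  have "f holomorphic_on ball 0 (norm z + 1)"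
    using assms holomorphic_on_subset by (auto simp: entire_functions_def)
  from holomorphic_power_series[OF this, of z] show ?thesis
    by (simp add: fps_expansion_def)
qed

lemma entire_bounded_on_cball:
  assumes "f \<in> entire_functions"
  shows "\<exists>M\<ge>0. \<forall>z. norm z \<le> R \<longrightarrow> norm (f z) \<le> M"
proof -
  have "compact (f ` cball 0 R)"
    using assms
    by (intro compact_continuous_image)
      (auto simp: entire_functions_def intro: holomorphic_on_imp_continuous_on holomorphic_on_subset)
  then obtain M where "\<forall>w\<in>f ` cball 0 R. norm w \<le> M"
    by (meson bounded_iff compact_imp_bounded)
  then show ?thesis
    by (intro exI[of _ "max M 0"]) (auto simp: le_max_iff_disj)
qed

lemma germs_iff: "b \<in> germs \<longleftrightarrow> (\<exists>C R. R > 0 \<and> (\<forall>n. norm (fps_nth b n) \<le> C * R ^ n))"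
proof
  have weight: "(2::real) powi (2 * int n * (- int p)) = (1 / (2 ^ p) ^ n)\<^sup>2" for n p
    by (simp add: power_int_minus power_int_def nat_mult_distrib power_mult[symmetric]
        power_divide field_simps flip: of_nat_mult)
  {
    assume "b \<in> germs"
    then obtain p where "summable (\<lambda>n. (norm (fps_nth b n))\<^sup>2 * 2 powi (2 * int n * (- int p)))"
      by (auto simp: germs_def H2_def)
    then have "summable (\<lambda>n. (norm (fps_nth b n) / (2 ^ p) ^ n)\<^sup>2)"
      by (simp only: weight power_mult_distrib[symmetric]) simp
    then have "Bseq (\<lambda>n. (norm (fps_nth b n) / (2 ^ p) ^ n)\<^sup>2)"
      by (metis convergentI convergent_imp_Bseq summable_LIMSEQ_zero)
    then obtain C where C: "\<And>n. norm ((norm (fps_nth b n) / (2 ^ p) ^ n)\<^sup>2) \<le> C"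
      by (rule BseqE) blast
    have "norm (fps_nth b n) \<le> (C + 1) * (2 ^ p) ^ n" for n
    proof -
      define x where "x = norm (fps_nth b n) / (2 ^ p) ^ n"
      have "x\<^sup>2 \<le> C" using C[of n] by (simp add: x_def)
      moreover have "2 * x \<le> x\<^sup>2 + 1"
        using zero_le_power2[of "x - 1"] by (simp add: power2_diff)
      moreover have "0 \<le> x" by (simp add: x_def)
      ultimately have "x \<le> C + 1" by linarith
      then show ?thesis by (simp add: x_def field_simps)
    qed
    then show "\<exists>C R. R > 0 \<and> (\<forall>n. norm (fps_nth b n) \<le> C * R ^ n)"
      by (intro exI[of _ "C + 1"] exI[of _ "2 ^ p"]) auto
  next
    assume "\<exists>C R. R > 0 \<and> (\<forall>n. norm (fps_nth b n) \<le> C * R ^ n)"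
    then obtain C R where R: "R > 0" and b: "\<And>n. norm (fps_nth b n) \<le> C * R ^ n" by blast
    obtain p where p: "R < 2 ^ p" using real_arch_pow[of 2 R] by auto
    define q where "q = R / 2 ^ p"
    have q: "0 < q" "q < 1" using R p by (auto simp: q_def)
    have "summable (\<lambda>n. (norm (fps_nth b n) / (2 ^ p) ^ n)\<^sup>2)"
    proof (rule summable_comparison_test')
      show "summable (\<lambda>n. C\<^sup>2 * (q\<^sup>2) ^ n)"
        using q by (intro summable_mult summable_geometric) (simp add: power_less_one_iff abs_square_less_1)
      fix n
      have "norm (fps_nth b n) / (2 ^ p) ^ n \<le> C * q ^ n"
        using b[of n] by (simp add: q_def power_divide field_simps)
      then have "(norm (fps_nth b n) / (2 ^ p) ^ n)\<^sup>2 \<le> (C * q ^ n)\<^sup>2"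
        by (intro power_mono) auto
      then show "norm ((norm (fps_nth b n) / (2 ^ p) ^ n)\<^sup>2) \<le> C\<^sup>2 * (q\<^sup>2) ^ n"
        by (simp add: power_mult_distrib power_mult[symmetric] mult.commute)
    qed
    then have "b \<in> H2 (- int p)"
      unfolding H2_def mem_Collect_eq weight power_mult_distrib[symmetric] by simp
    then show "b \<in> germs" by (auto simp: germs_def)
  }
qed

lemma dual_pairing_bound:
  assumes "b \<in> germs"
  obtains C R where "C \<ge> 0" "R > 0"
    "\<And>f M. f \<in> entire_functions \<Longrightarrow> (\<And>z. norm z \<le> R \<Longrightarrow> norm (f z) \<le> M) \<Longrightarrow>
       summable (\<lambda>n. norm (fps_nth (fps_expansion f 0) n * fps_nth b n)) \<and>
       norm (dual_pairing b f) \<le> C * M"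
proof -
  obtain C R where R: "R > 0" and b: "\<And>n. norm (fps_nth b n) \<le> C * R ^ n"
    using assms germs_iff by blast
  have C: "C \<ge> 0" using order_trans[OF norm_ge_zero b[of 0]] by simp
  show thesis
  proof (rule that[of "2 * C" "2 * R"])
    fix f M assume f: "f \<in> entire_functions" and M: "\<And>z. norm z \<le> 2 * R \<Longrightarrow> norm (f z) \<le> M"
    have M0: "M \<ge> 0" using order_trans[OF norm_ge_zero M[of 0]] R by simp
    have le: "norm (fps_nth (fps_expansion f 0) n * fps_nth b n) \<le> C * M * (1 / 2) ^ n" for n
    proof -
      have "norm (fps_nth (fps_expansion f 0) n * fps_nth b n) \<le> M / (2 * R) ^ n * (C * R ^ n)"
        unfolding norm_mult
        by (intro mult_mono entire_coeff_bound[OF f] b) (use R M M0 in auto)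
      also have "\<dots> = C * M * (1 / 2) ^ n"
        using R by (simp add: power_mult_distrib power_divide field_simps)
      finally show ?thesis .
    qed
    have g: "(\<lambda>n. C * M * (1 / 2) ^ n) sums (C * M * 2)"
      using sums_mult[OF geometric_sums[of "1 / 2 :: real"], of "C * M"] by simp
    have sm: "summable (\<lambda>n. norm (fps_nth (fps_expansion f 0) n * fps_nth b n))"
      by (rule summable_comparison_test'[OF sums_summable[OF g]]) (use le in auto)
    have "norm (dual_pairing b f) \<le> (\<Sum>n. norm (fps_nth (fps_expansion f 0) n * fps_nth b n))"
      unfolding dual_pairing_def by (rule summable_norm[OF sm])
    also have "\<dots> \<le> C * M * 2"
      using suminf_le[OF le sm sums_summable[OF g]] sums_unique[OF g] by simp
    finally show "summable (\<lambda>n. norm (fps_nth (fps_expansion f 0) n * fps_nth b n)) \<and>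
       norm (dual_pairing b f) \<le> 2 * C * M"
      using sm by (simp add: mult_ac)
  qed (use C R in auto)
qed

lemma fps_expansion_add_entire:
  assumes "f \<in> entire_functions" "g \<in> entire_functions"
  shows "fps_expansion (\<lambda>z. f z + g z) 0 = fps_expansion f 0 + fps_expansion g 0"
  using assms
  by (auto simp: fps_eq_iff fps_expansion_def entire_functions_def add_divide_distrib
      higher_deriv_add[of _ UNIV])

lemma fps_expansion_scale_entire:
  assumes "f \<in> entire_functions"
  shows "fps_expansion (\<lambda>z. c * f z) 0 = fps_const c * fps_expansion f 0"
  using assms
  by (auto simp: fps_eq_iff fps_expansion_def entire_functions_def
      higher_deriv_cmult[of _ UNIV])

definition continuous_functional :: "((complex \<Rightarrow> complex) \<Rightarrow> complex) \<Rightarrow> bool" where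
  "continuous_functional \<phi> \<longleftrightarrow>
     (\<forall>f\<in>entire_functions. \<forall>g\<in>entire_functions. \<phi> (\<lambda>z. f z + g z) = \<phi> f + \<phi> g) \<and>
     (\<forall>c. \<forall>f\<in>entire_functions. \<phi> (\<lambda>z. c * f z) = c * \<phi> f) \<and>
     continuous_map entire_topology euclidean \<phi>"

lemma dual_pairing_summable:
  assumes "b \<in> germs" "f \<in> entire_functions"
  shows "summable (\<lambda>n. fps_nth (fps_expansion f 0) n * fps_nth b n)"
proof (rule dual_pairing_bound[OF assms(1)])
  fix C R
  assume CR: "\<And>f M. f \<in> entire_functions \<Longrightarrow> (\<And>z. norm z \<le> R \<Longrightarrow> norm (f z) \<le> M) \<Longrightarrow>
       summable (\<lambda>n. norm (fps_nth (fps_expansion f 0) n * fps_nth b n)) \<and>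
       norm (dual_pairing b f) \<le> C * M"
  obtain M where "M \<ge> 0" and M: "\<And>z. norm z \<le> R \<Longrightarrow> norm (f z) \<le> M"
    using entire_bounded_on_cball[OF assms(2), of R] by blast
  have "summable (\<lambda>n. norm (fps_nth (fps_expansion f 0) n * fps_nth b n))"
    using CR[OF assms(2) M] by (rule conjunct1)
  then show ?thesis by (rule summable_norm_cancel)
qed

lemma continuous_functional_dual_pairing:
  assumes "b \<in> germs"
  shows "continuous_functional (dual_pairing b)"
  unfolding continuous_functional_def
proof (intro conjI ballI allI)
  show add: "dual_pairing b (\<lambda>z. f z + g z) = dual_pairing b f + dual_pairing b g"
    if "f \<in> entire_functions" "g \<in> entire_functions" for f g
    using that dual_pairing_summable[OF assms]
    by (simp add: dual_pairing_def fps_expansion_add_entire ring_distribs suminf_add)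
  show scale: "dual_pairing b (\<lambda>z. c * f z) = c * dual_pairing b f"
    if "f \<in> entire_functions" for c f
    using that dual_pairing_summable[OF assms that]
    by (simp add: dual_pairing_def fps_expansion_scale_entire mult.assoc suminf_mult)
  obtain C R where C: "C \<ge> 0"
    and CR: "\<And>f M. f \<in> entire_functions \<Longrightarrow> (\<And>z. norm z \<le> R \<Longrightarrow> norm (f z) \<le> M) \<Longrightarrow>
       norm (dual_pairing b f) \<le> C * M"
  proof (rule dual_pairing_bound[OF assms])
    fix C R
    assume *: "C \<ge> 0" "\<And>f M. f \<in> entire_functions \<Longrightarrow> (\<And>z. norm z \<le> R \<Longrightarrow> norm (f z) \<le> M) \<Longrightarrow>
       summable (\<lambda>n. norm (fps_nth (fps_expansion f 0) n * fps_nth b n)) \<and>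
       norm (dual_pairing b f) \<le> C * M"
    show thesis by (rule that[OF *(1) conjunct2[OF *(2)]])
  qed
  have "openin entire_topology {f \<in> entire_functions. dual_pairing b f \<in> W}" if W: "open W" for W
    unfolding openin_entire_topology
  proof (intro conjI ballI)
    fix f assume f: "f \<in> {f \<in> entire_functions. dual_pairing b f \<in> W}"
    then obtain e where e: "e > 0" "ball (dual_pairing b f) e \<subseteq> W"
      using W open_contains_ball by blast
    define d where "d = e / (C + 1)"
    have d: "d > 0" "C * d < e" using e(1) C by (auto simp: d_def field_simps)
    have "dual_pairing b g \<in> W" if g: "g \<in> entire_nhd f (cball 0 R) d" for g
    proof -
      let ?h = "\<lambda>z. g z + - 1 * f z"
      have ge: "g \<in> entire_functions" and fe: "(\<lambda>z. - 1 * f z) \<in> entire_functions"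
        using f g by (auto simp: entire_nhd_def entire_functions_def intro!: holomorphic_intros)
      have "?h \<in> entire_functions"
        using ge fe unfolding entire_functions_def mem_Collect_eq by (rule holomorphic_on_add)
      then have "norm (dual_pairing b ?h) \<le> C * d"
        by (rule CR) (use g in \<open>auto simp: entire_nhd_def intro: less_imp_le\<close>)
      also have "dual_pairing b ?h = dual_pairing b g - dual_pairing b f"
        using add[OF ge fe] scale[of f "- 1"] f by simp
      finally show ?thesis
        using e(2) d(2) by (auto simp: dist_norm norm_minus_commute)
    qed
    then show "\<exists>K e. compact K \<and> e > 0 \<and>
        entire_nhd f K e \<subseteq> {f \<in> entire_functions. dual_pairing b f \<in> W}"
      using d(1) by (intro exI[of _ "cball 0 R"] exI[of _ d]) (auto simp: entire_nhd_def)
  qed auto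
  then show "continuous_map entire_topology euclidean (dual_pairing b)"
    unfolding continuous_map_def by (simp flip: open_openin)
qed

lemma continuous_functional_unique_germ:
  assumes \<phi>: "continuous_functional \<phi>"
  shows "\<exists>!b. b \<in> germs \<and> (\<forall>f\<in>entire_functions. dual_pairing b f = \<phi> f)"
proof -
  have add: "\<phi> (\<lambda>z. f z + g z) = \<phi> f + \<phi> g"
    if "f \<in> entire_functions" "g \<in> entire_functions" for f g
    using \<phi> that by (simp add: continuous_functional_def)
  have scale: "\<phi> (\<lambda>z. c * f z) = c * \<phi> f" if "f \<in> entire_functions" for c f
    using \<phi> that by (simp add: continuous_functional_def)
  have zero_entire: "(\<lambda>z. 0) \<in> entire_functions" and mono: "(\<lambda>z. z ^ n) \<in> entire_functions" for n
    by (auto simp: entire_functions_def intro!: holomorphic_intros)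
  have zero: "\<phi> (\<lambda>z. 0) = 0"
    using scale[OF zero_entire, of 0] by simp
  have "openin entire_topology {f \<in> entire_functions. \<phi> f \<in> ball 0 1}"
    using \<phi> open_ball[of "0::complex" 1] unfolding continuous_functional_def continuous_map_def
    unfolding topspace_entire_topology by (metis open_openin)
  moreover have "(\<lambda>z. 0) \<in> {f \<in> entire_functions. \<phi> f \<in> ball 0 1}"
    using zero zero_entire by simp
  ultimately obtain K d where K: "compact K" "d > 0"
    and Kd: "entire_nhd (\<lambda>z. 0) K d \<subseteq> {f \<in> entire_functions. \<phi> f \<in> ball 0 1}"
    unfolding openin_entire_topology by meson
  obtain R where R: "R > 0" "\<And>z. z \<in> K \<Longrightarrow> norm z \<le> R"
    using compact_imp_bounded[OF K(1)] bounded_pos by metis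
  have bound: "norm (\<phi> f) \<le> 2 * M / d"
    if f: "f \<in> entire_functions" and M: "M > 0" "\<And>z. norm z \<le> R \<Longrightarrow> norm (f z) \<le> M" for f M
  proof -
    let ?c = "of_real (d / (2 * M)) :: complex"
    have c: "norm ?c = d / (2 * M)"
      using M(1) K(2) unfolding norm_of_real by simp
    have "norm (?c * f z) < d" if "z \<in> K" for z
    proof -
      have "norm (?c * f z) \<le> d / (2 * M) * M"
        unfolding norm_mult c using M R(2)[OF that] K(2) by (intro mult_mono) auto
      also have "\<dots> < d" using M K(2) by simp
      finally show ?thesis .
    qed
    moreover have "(\<lambda>z. ?c * f z) \<in> entire_functions"
      using f unfolding entire_functions_def mem_Collect_eq by (intro holomorphic_intros)
    ultimately have "(\<lambda>z. ?c * f z) \<in> entire_nhd (\<lambda>z. 0) K d"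
      by (simp add: entire_nhd_def)
    then have "norm (\<phi> (\<lambda>z. ?c * f z)) < 1" using Kd by auto
    then have "d / (2 * M) * norm (\<phi> f) < 1"
      unfolding scale[OF f] norm_mult c .
    then show ?thesis using K(2) M(1) by (simp add: field_simps)
  qed
  define b where "b = Abs_fps (\<lambda>n. \<phi> (\<lambda>z. z ^ n))"
  have b_germ: "b \<in> germs"
    unfolding germs_iff
  proof (intro exI conjI allI)
    show "norm (fps_nth b n) \<le> 2 / d * R ^ n" for n
      using bound[OF mono, of "R ^ n" n] R(1)
      by (simp add: b_def norm_power power_mono)
  qed (use R in auto)
  have b_eq: "dual_pairing b f = \<phi> f" if f: "f \<in> entire_functions" for f
  proof -
    define a where "a = fps_nth (fps_expansion f 0)"
    define S where "S N = (\<lambda>z. \<Sum>n<N. a n * z ^ n)" for N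
    have S: "S N \<in> entire_functions" for N
      unfolding S_def entire_functions_def mem_Collect_eq by (intro holomorphic_intros)
    have \<phi>S: "\<phi> (S N) = (\<Sum>n<N. a n * fps_nth b n)" for N
    proof (induction N)
      case (Suc N)
      have m: "(\<lambda>z. a N * z ^ N) \<in> entire_functions"
        unfolding entire_functions_def mem_Collect_eq by (intro holomorphic_intros)
      have "\<phi> (S (Suc N)) = \<phi> (\<lambda>z. S N z + a N * z ^ N)" by (simp add: S_def)
      also have "\<dots> = \<phi> (S N) + a N * fps_nth b N"
        by (simp add: add[OF S m] scale[OF mono] b_def)
      finally show ?case using Suc.IH by simp
    qed (simp add: S_def zero)
    obtain M where M: "M \<ge> 0" "\<And>z. norm z \<le> 2 * R \<Longrightarrow> norm (f z) \<le> M"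
      using entire_bounded_on_cball[OF f, of "2 * R"] by blast
    have a: "norm (a n) \<le> M / (2 * R) ^ n" for n
      unfolding a_def by (rule entire_coeff_bound[OF f]) (use R M in auto)
    have le: "norm (\<phi> f - \<phi> (S N)) \<le> 2 * (2 * (M + 1) * (1 / 2) ^ N) / d" for N
    proof -
      let ?h = "\<lambda>z. f z + - 1 * S N z"
      have m: "(\<lambda>z. - 1 * S N z) \<in> entire_functions"
        using S[of N] unfolding entire_functions_def mem_Collect_eq by (intro holomorphic_intros)
      have h: "?h \<in> entire_functions"
        using f m unfolding entire_functions_def mem_Collect_eq by (rule holomorphic_on_add)
      have "norm (?h z) \<le> 2 * (M + 1) * (1 / 2) ^ N" if z: "norm z \<le> R" for z
      proof -
        have "(\<lambda>n. a n * z ^ n) sums f z" unfolding a_def by (rule entire_sums[OF f])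
        then have 1: "(\<lambda>n. a (n + N) * z ^ (n + N)) sums (f z - S N z)"
          unfolding S_def by (rule sums_split_initial_segment)
        have 2: "norm (a (n + N) * z ^ (n + N)) \<le> M * (1 / 2) ^ N * (1 / 2) ^ n" for n
        proof -
          have "norm (a (n + N) * z ^ (n + N)) \<le> M / (2 * R) ^ (n + N) * R ^ (n + N)"
            unfolding norm_mult norm_power
            using a M(1) R(1) z by (intro mult_mono power_mono) auto
          also have "\<dots> = M * (1 / 2) ^ (n + N)"
            using R(1) by (simp add: power_mult_distrib power_divide)
          finally show ?thesis by (simp add: power_add mult_ac)
        qed
        have 3: "(\<lambda>n. M * (1 / 2) ^ N * (1 / 2) ^ n) sums (M * (1 / 2) ^ N * 2)"
          using sums_mult[OF geometric_sums[of "1 / 2 :: real"], of "M * (1 / 2) ^ N"] by simp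
        have "norm (\<Sum>n. a (n + N) * z ^ (n + N)) \<le> (\<Sum>n. M * (1 / 2) ^ N * (1 / 2) ^ n)"
          by (rule norm_suminf_le[OF 2 sums_summable[OF 3]])
        then have "norm (f z - S N z) \<le> M * (1 / 2) ^ N * 2"
          using sums_unique[OF 1] sums_unique[OF 3] by simp
        also have "\<dots> \<le> 2 * (M + 1) * (1 / 2) ^ N" by simp
        finally show ?thesis by simp
      qed
      then have "norm (\<phi> ?h) \<le> 2 * (2 * (M + 1) * (1 / 2) ^ N) / d"
        by (intro bound[OF h]) (use M in auto)
      also have "\<phi> ?h = \<phi> f - \<phi> (S N)"
        using add[OF f m] scale[OF S, of "- 1" N] by simp
      finally show ?thesis .
    qed
    have "(\<lambda>N. 2 * (2 * (M + 1) * (1 / 2) ^ N) / d) \<longlonglongrightarrow> 2 * (2 * (M + 1) * 0) / d"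
      using K(2) by (intro tendsto_intros LIMSEQ_power_zero) auto
    then have lim: "(\<lambda>N. 2 * (2 * (M + 1) * (1 / 2) ^ N) / d) \<longlonglongrightarrow> 0"
      by simp
    have "eventually (\<lambda>N. norm (\<phi> f - \<phi> (S N)) \<le> 2 * (2 * (M + 1) * (1 / 2) ^ N) / d) sequentially"
      using le by (rule always_eventually[OF allI])
    then have "(\<lambda>N. \<phi> f - \<phi> (S N)) \<longlonglongrightarrow> 0"
      using lim by (rule Lim_null_comparison)
    from tendsto_diff[OF tendsto_const[of "\<phi> f"] this]
    have "(\<lambda>N. \<phi> f - (\<phi> f - \<phi> (S N))) \<longlonglongrightarrow> \<phi> f - 0" .
    then have "(\<lambda>n. a n * fps_nth b n) sums \<phi> f"
      by (simp add: sums_def \<phi>S)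
    then show ?thesis
      by (simp add: dual_pairing_def a_def sums_iff)
  qed
  have b_unique: "c = b" if c: "\<forall>f\<in>entire_functions. dual_pairing c f = \<phi> f" for c
  proof (rule fps_ext)
    fix n
    have "fps_nth (fps_expansion (\<lambda>z::complex. z ^ n) 0) k = (if k = n then 1 else 0)" for k
      using fps_nth_fps_expansion[OF has_fps_expansion_power[OF has_fps_expansion_fps_X], of n k]
      by (simp add: fps_expansion_def)
    then have "dual_pairing c (\<lambda>z. z ^ n) = (\<Sum>k. if k = n then fps_nth c k else 0)"
      unfolding dual_pairing_def by (intro arg_cong[of _ _ suminf]) auto
    also have "\<dots> = fps_nth c n"
      using sums_single[of n "fps_nth c"] by (simp add: sums_iff)
    finally show "fps_nth c n = fps_nth b n"
      using c mono by (simp add: b_def)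
  qed
  show ?thesis
  proof (rule ex1I[of _ b])
    show "b \<in> germs \<and> (\<forall>f\<in>entire_functions. dual_pairing b f = \<phi> f)"
      using b_germ b_eq by simp
  qed (rule b_unique, rule conjunct2)
qed

definition germ_nhd ::
    "complex fps \<Rightarrow> (complex \<Rightarrow> complex) set \<Rightarrow> real \<Rightarrow> complex fps set" where
  "germ_nhd b B e = {c \<in> germs. \<forall>f\<in>B. norm (dual_pairing (c - b) f) < e}"

text \<open>The topology of uniform convergence on the bounded sets of entire functions.\<close>

definition germ_topology :: "complex fps topology" where
  "germ_topology = topology (\<lambda>U. U \<subseteq> germs \<and>
     (\<forall>b\<in>U. \<exists>B e. entire_bounded B \<and> e > 0 \<and> germ_nhd b B e \<subseteq> U))"

lemma entire_bounded_empty: "entire_bounded {}"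
  by (auto simp: entire_bounded_def intro: exI[of _ 1])

lemma entire_bounded_Un:
  assumes "entire_bounded A" "entire_bounded B"
  shows "entire_bounded (A \<union> B)"
  unfolding entire_bounded_def
proof (intro conjI allI impI)
  fix U assume U: "openin entire_topology U \<and> (\<lambda>z. 0) \<in> U"
  obtain r where r: "r > 0" "\<forall>t\<ge>r::real. A \<subseteq> (\<lambda>f z. of_real t * f z) ` U"
    using assms(1) U unfolding entire_bounded_def by meson
  obtain r' where r': "r' > 0" "\<forall>t\<ge>r'::real. B \<subseteq> (\<lambda>f z. of_real t * f z) ` U"
    using assms(2) U unfolding entire_bounded_def by meson
  show "\<exists>r>0. \<forall>t\<ge>r::real. A \<union> B \<subseteq> (\<lambda>f z. of_real t * f z) ` U"
    by (rule exI[of _ "max r r'"]) (use r r' in auto)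
qed (use assms in \<open>auto simp: entire_bounded_def\<close>)

lemma openin_germ_topology:
  "openin germ_topology U \<longleftrightarrow> U \<subseteq> germs \<and>
     (\<forall>b\<in>U. \<exists>B e. entire_bounded B \<and> e > 0 \<and> germ_nhd b B e \<subseteq> U)"
proof -
  let ?P = "\<lambda>U. U \<subseteq> germs \<and>
     (\<forall>b\<in>U. \<exists>B e. entire_bounded B \<and> e > 0 \<and> germ_nhd b B e \<subseteq> U)"
  have "?P (S \<inter> T)" if S: "?P S" and T: "?P T" for S T
  proof (intro conjI ballI)
    fix b assume "b \<in> S \<inter> T"
    then obtain A e B d where "entire_bounded A" "e > 0" "germ_nhd b A e \<subseteq> S"
      "entire_bounded B" "d > 0" "germ_nhd b B d \<subseteq> T"
      using S T by (meson IntD1 IntD2)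
    then show "\<exists>B e. entire_bounded B \<and> e > 0 \<and> germ_nhd b B e \<subseteq> S \<inter> T"
      by (intro exI[of _ "A \<union> B"] exI[of _ "min e d"])
        (auto simp: germ_nhd_def entire_bounded_Un)
  qed (use S in auto)
  moreover have "?P (\<Union>\<K>)" if \<K>: "\<forall>K\<in>\<K>. ?P K" for \<K>
  proof (intro conjI ballI)
    fix b assume "b \<in> \<Union>\<K>"
    then obtain S where S: "S \<in> \<K>" "b \<in> S" by blast
    then obtain B e where "entire_bounded B" "e > 0" "germ_nhd b B e \<subseteq> S"
      using bspec[OF \<K> S(1)] by meson
    then show "\<exists>B e. entire_bounded B \<and> e > 0 \<and> germ_nhd b B e \<subseteq> \<Union>\<K>"
      using S by blast
  qed (use \<K> in blast)
  ultimately have "istopology ?P"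
    unfolding istopology_def by simp
  then show ?thesis
    by (simp add: germ_topology_def topology_inverse')
qed

lemma openin_germs: "openin germ_topology germs"
  by (auto simp: openin_germ_topology germ_nhd_def entire_bounded_empty
      intro!: exI[of _ "{}"] exI[of _ 1])

lemma topspace_germ_topology [simp]: "topspace germ_topology = germs"
  using openin_germs openin_germ_topology[of "topspace germ_topology"]
  by (meson openin_subset openin_topspace subset_antisym)

definition germ_units :: "complex fps set" where
  "germ_units = {f \<in> germs. \<exists>g\<in>germs. f * g = 1}"

definition germ_inverse :: "complex fps \<Rightarrow> complex fps" where
  "germ_inverse f = (THE g. g \<in> germs \<and> f * g = 1)"

end

(* A positive sequence r decreasing to 0 makes the weights w_n = r_n^n submultiplicative,
   w_(m+k) <= w_m * w_k, so that x |-> sum_n w_n |x_n| is a submultiplicative norm on power series.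
   It is finite on every germ, and every rapidly decreasing sequence of numbers is dominated by a
   multiple of such weights. Applied to the suprema of the Taylor coefficients over a bounded set of
   entire functions, this shows that these norms define the strong topology; hence multiplication and
   inversion are continuous as in a normed algebra. Doubling r multiplies w_n by 2^n, so the expansion
   in monomials is a nuclear representation of the map from the norm of 2r to the norm of r. *)
theory Submission
  imports Defs
begin

section \<open>Germs\<close>

text \<open>Geometric growth of the coefficients amounts to a positive radius of convergence. In
  this form the facts on \<open>fps_conv_radius\<close> give the closure of \<open>germs\<close>
  under sums, products and inverses.\<close>

lemma germs_iff_conv_radius: "x \<in> germs \<longleftrightarrow> fps_conv_radius x > 0"
proof
  assume "x \<in> germs"
  then obtain C R where R: "R > 0" and x: "\<And>n. norm (fps_nth x n) \<le> C * R ^ n"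
    using germs_iff by blast
  \<comment> \<open>At the point \<open>1 / (2 * R)\<close> the bound \<open>C * R ^ n\<close>
    leaves a geometric series of ratio 1/2, so the radius of convergence is at least
    \<open>1 / (2 * R)\<close>.\<close>
  have "summable (\<lambda>n. fps_nth x n * (of_real (1 / (2 * R))) ^ n)"
  proof (rule summable_comparison_test')
    show "summable (\<lambda>n. C * (1 / 2 :: real) ^ n)"
      by (intro summable_mult summable_geometric) simp
    fix n
    have "norm (fps_nth x n) * (1 / (2 * R)) ^ n \<le> C * R ^ n * (1 / (2 * R)) ^ n"
      using x R by (intro mult_right_mono) auto
    also have "\<dots> = C * (1 / 2) ^ n"
      using R by (simp add: power_mult_distrib power_divide)
    finally show "norm (fps_nth x n * (of_real (1 / (2 * R))) ^ n) \<le> C * (1 / 2) ^ n"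
      using R by (simp only: norm_mult norm_power norm_of_real) simp
  qed
  then have "conv_radius (fps_nth x) \<ge> norm (of_real (1 / (2 * R)) :: complex)"
    by (rule conv_radius_geI)
  moreover have "norm (of_real (1 / (2 * R)) :: complex) > 0"
    using R by (simp only: norm_of_real) simp
  ultimately show "fps_conv_radius x > 0"
    unfolding fps_conv_radius_def by (metis ereal_less(2) less_le_trans)
next
  assume "fps_conv_radius x > 0"
  then obtain t where t: "0 < t" "ereal t < fps_conv_radius x"
    by (metis ereal_dense2 ereal_less(2))
  then have "summable (\<lambda>n. fps_nth x n * of_real t ^ n)"
    unfolding fps_conv_radius_def by (intro summable_in_conv_radius) simp
  then have "Bseq (\<lambda>n. fps_nth x n * of_real t ^ n)" by (rule summable_imp_Bseq)
  then obtain C where C: "\<And>n. norm (fps_nth x n * of_real t ^ n) \<le> C"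
    by (rule BseqE) blast
  have "norm (fps_nth x n) \<le> C * (1 / t) ^ n" for n
    using C[of n] t(1) by (simp add: norm_mult norm_power power_divide field_simps)
  then show "x \<in> germs" using t(1) unfolding germs_iff by (intro exI[of _ C] exI[of _ "1 / t"]) auto
qed

section \<open>Closure of the germs under the algebraic operations\<close>

lemma germs_closed [simp]:
  "0 \<in> germs" "fps_X ^ n \<in> germs" "fps_const c \<in> germs"
  by (simp_all add: germs_iff_conv_radius)

lemma germs_add: "x \<in> germs \<Longrightarrow> y \<in> germs \<Longrightarrow> x + y \<in> germs"
  using fps_conv_radius_add[of x y] by (auto simp: germs_iff_conv_radius min_def split: if_splits)

lemma germs_mult: "x \<in> germs \<Longrightarrow> y \<in> germs \<Longrightarrow> x * y \<in> germs"
  using fps_conv_radius_mult[of x y] by (auto simp: germs_iff_conv_radius min_def split: if_splits)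

lemma germs_diff: "x \<in> germs \<Longrightarrow> y \<in> germs \<Longrightarrow> x - y \<in> germs"
  using fps_conv_radius_diff[of x y] by (auto simp: germs_iff_conv_radius min_def split: if_splits)

lemma germs_scale: "x \<in> germs \<Longrightarrow> germ_scale c x \<in> germs"
  by (simp add: germ_scale_def germs_mult)

lemma germs_sum: "(\<And>i. i \<in> A \<Longrightarrow> f i \<in> germs) \<Longrightarrow> sum f A \<in> germs"
  by (induction A rule: infinite_finite_induct) (auto intro: germs_add)

lemma germs_inverse: "x \<in> germs \<Longrightarrow> fps_nth x 0 \<noteq> 0 \<Longrightarrow> inverse x \<in> germs"
  using fps_conv_radius_inverse_pos by (simp add: germs_iff_conv_radius)

lemma fps_nth_germ_scale [simp]: "fps_nth (germ_scale c x) n = c * fps_nth x n"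
  by (simp add: germ_scale_def)

section \<open>Invertible germs\<close>

text \<open>The constant coefficient is multiplicative, so that of a unit cannot vanish. Conversely,
  the formal inverse of a germ with nonzero constant coefficient again has positive radius of
  convergence.\<close>

lemma germ_units_iff: "f \<in> germs \<Longrightarrow> f \<in> germ_units \<longleftrightarrow> fps_nth f 0 \<noteq> 0"
proof
  assume "f \<in> germ_units"
  then obtain g where "f * g = 1" by (auto simp: germ_units_def)
  then have "fps_nth f 0 * fps_nth g 0 = 1" by (metis fps_mult_nth_0 fps_one_nth)
  then show "fps_nth f 0 \<noteq> 0" by auto
next
  assume "f \<in> germs" "fps_nth f 0 \<noteq> 0"
  then show "f \<in> germ_units"
    using germs_inverse[of f] inverse_mult_eq_1'[of f] by (auto simp: germ_units_def)
qed

text \<open>Inverses are unique, so the definite description selects the formal inverse and the laws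
  of \<open>inverse\<close> become available.\<close>

lemma germ_inverse_eq:
  assumes "f \<in> germs" "fps_nth f 0 \<noteq> 0"
  shows "germ_inverse f = inverse f"
  unfolding germ_inverse_def
proof (rule the_equality)
  fix g assume g: "g \<in> germs \<and> f * g = 1"
  then have "inverse f * (f * g) = inverse f" by simp
  then show "g = inverse f"
    using inverse_mult_eq_1[OF assms(2)] by (simp flip: mult.assoc)
qed (use assms germs_inverse inverse_mult_eq_1' in auto)


section \<open>Submultiplicative norms\<close>

text \<open>Monotonicity gives submultiplicativity in \<open>wnorm_mult\<close>; the limit 0 gives
  summability on every germ, by \<open>radii_summable\<close>.\<close>

definition radii :: "(nat \<Rightarrow> real) \<Rightarrow> bool" where
  "radii r \<longleftrightarrow> (\<forall>n. 0 < r n) \<and> decseq r \<and> r \<longlonglongrightarrow> 0"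

text \<open>A weighted l1 norm of the coefficients. The weight at index 0 is 1, whatever
  \<open>r 0\<close> is. Outside \<open>germs\<close> the series may diverge, hence the membership
  hypotheses below.\<close>

definition wnorm :: "(nat \<Rightarrow> real) \<Rightarrow> complex fps \<Rightarrow> real" where
  "wnorm r x = (\<Sum>n. r n ^ n * norm (fps_nth x n))"

lemma wnorm_zero [simp]: "wnorm r 0 = 0"
  by (simp add: wnorm_def)

lemma wnorm_minus_commute: "wnorm r (x - y) = wnorm r (y - x)"
  by (simp add: wnorm_def norm_minus_commute)

lemma radii_pos: "radii r \<Longrightarrow> 0 < r n"
  by (simp add: radii_def)

lemma radii_double:
  assumes "radii r"
  shows "radii (\<lambda>n. 2 * r n)"
proof -
  have "(\<lambda>n. 2 * r n) \<longlonglongrightarrow> 2 * 0"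
    using assms by (intro tendsto_intros) (auto simp: radii_def)
  then show ?thesis using assms by (auto simp: radii_def decseq_def)
qed

text \<open>As \<open>r\<close> tends to 0, eventually \<open>r n * R\<close> is at most 1/2 and the
  terms lie below a geometric series.\<close>

lemma radii_summable:
  assumes "radii r" "R > 0"
  shows "summable (\<lambda>n. r n ^ n * R ^ n)"
proof (rule summable_comparison_test_ev)
  show "summable (\<lambda>n. (1 / 2 :: real) ^ n)" by (rule summable_geometric) simp
  have "eventually (\<lambda>n. r n < 1 / (2 * R)) sequentially"
    using assms by (intro order_tendstoD) (auto simp: radii_def)
  then show "eventually (\<lambda>n. norm (r n ^ n * R ^ n) \<le> (1 / 2) ^ n) sequentially"
  proof eventually_elim
    case (elim n)
    have "r n * R \<le> 1 / 2" using elim assms(2) by (simp add: field_simps)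
    then have "(r n * R) ^ n \<le> (1 / 2) ^ n"
      using radii_pos[OF assms(1), of n] assms(2) by (intro power_mono) auto
    then show ?case
      using radii_pos[OF assms(1), of n] assms(2) by (simp add: power_mult_distrib)
  qed
qed

lemma wnorm_summable:
  assumes "radii r" "x \<in> germs"
  shows "summable (\<lambda>n. r n ^ n * norm (fps_nth x n))"
proof -
  obtain C R where R: "R > 0" and x: "\<And>n. norm (fps_nth x n) \<le> C * R ^ n"
    using assms germs_iff by blast
  show ?thesis
  proof (rule summable_comparison_test')
    show "summable (\<lambda>n. C * (r n ^ n * R ^ n))"
      by (intro summable_mult radii_summable assms R)
    fix n
    have "r n ^ n * norm (fps_nth x n) \<le> r n ^ n * (C * R ^ n)"
      using x radii_pos[OF assms(1), of n] by (intro mult_left_mono) auto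
    then show "norm (r n ^ n * norm (fps_nth x n)) \<le> C * (r n ^ n * R ^ n)"
      using radii_pos[OF assms(1), of n] by (simp add: mult_ac)
  qed
qed

context
  fixes r :: "nat \<Rightarrow> real"
  assumes r: "radii r"
begin

lemma wnorm_nonneg: "x \<in> germs \<Longrightarrow> 0 \<le> wnorm r x"
  unfolding wnorm_def
  by (intro suminf_nonneg wnorm_summable r) (use radii_pos[OF r] in \<open>simp_all add: less_imp_le\<close>)

lemma wnorm_coeff:
  assumes "x \<in> germs"
  shows "r n ^ n * norm (fps_nth x n) \<le> wnorm r x"
  using sum_le_suminf[OF wnorm_summable[OF r assms], of "{n}"] radii_pos[OF r]
  by (simp add: wnorm_def less_imp_le)

lemma wnorm_add:
  assumes "x \<in> germs" "y \<in> germs"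
  shows "wnorm r (x + y) \<le> wnorm r x + wnorm r y"
proof -
  have "wnorm r (x + y) \<le>
    (\<Sum>n. r n ^ n * norm (fps_nth x n) + r n ^ n * norm (fps_nth y n))"
    unfolding wnorm_def
  proof (rule suminf_le)
    show "r n ^ n * norm (fps_nth (x + y) n) \<le> r n ^ n * norm (fps_nth x n) + r n ^ n * norm (fps_nth y n)" for n
      using radii_pos[OF r, of n] norm_triangle_ineq[of "fps_nth x n" "fps_nth y n"]
      by (simp flip: distrib_left)
  qed (intro summable_add wnorm_summable r assms germs_add)+
  also have "\<dots> = wnorm r x + wnorm r y"
    unfolding wnorm_def by (intro suminf_add[symmetric] wnorm_summable r assms)
  finally show ?thesis .
qed

lemma wnorm_scale:
  assumes "x \<in> germs"
  shows "wnorm r (germ_scale c x) = norm c * wnorm r x"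
  unfolding wnorm_def suminf_mult[OF wnorm_summable[OF r assms], symmetric]
  by (simp add: norm_mult mult_ac)

lemma wnorm_triangle:
  assumes "x \<in> germs" "y \<in> germs" "z \<in> germs"
  shows "wnorm r (x - z) \<le> wnorm r (x - y) + wnorm r (y - z)"
  using wnorm_add[of "x - y" "y - z"] assms by (simp add: germs_diff)

text \<open>Estimating the coefficients of the product termwise reduces the claim to
  submultiplicativity of the weights; the resulting bound is the Cauchy product of the two norm
  series.\<close>

lemma wnorm_mult:
  assumes "x \<in> germs" "y \<in> germs"
  shows "wnorm r (x * y) \<le> wnorm r x * wnorm r y"
proof -
  let ?a = "\<lambda>n. r n ^ n * norm (fps_nth x n)" and ?b = "\<lambda>n. r n ^ n * norm (fps_nth y n)"
  \<comment> \<open>\<open>Cauchy_product_sums\<close> asks for absolute summability; nonnegative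
    terms are their own norms.\<close>
  have n: "norm (?a n) = ?a n" "norm (?b n) = ?b n" for n
    using radii_pos[OF r, of n] by simp_all
  have "summable (\<lambda>n. norm (?a n))" "summable (\<lambda>n. norm (?b n))"
    unfolding n by (intro wnorm_summable r assms)+
  note s = Cauchy_product_sums[OF this]
  have "wnorm r (x * y) \<le> (\<Sum>k. \<Sum>i\<le>k. ?a i * ?b (k - i))"
    unfolding wnorm_def
  proof (rule suminf_le)
    fix k
    have "r k ^ k * norm (fps_nth (x * y) k) \<le>
      r k ^ k * (\<Sum>i\<le>k. norm (fps_nth x i) * norm (fps_nth y (k - i)))"
      unfolding fps_mult_nth atLeast0AtMost using radii_pos[OF r, of k]
      by (intro mult_left_mono order_trans[OF norm_sum]) (auto simp: norm_mult)
    also have "\<dots> = (\<Sum>i\<le>k. r k ^ k * (norm (fps_nth x i) * norm (fps_nth y (k - i))))"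
      by (rule sum_distrib_left)
    also have "\<dots> \<le> (\<Sum>i\<le>k. ?a i * ?b (k - i))"
    proof (rule sum_mono)
      fix i assume "i \<in> {..k}"
      then have i: "i \<le> k" by simp
      \<comment> \<open>Both \<open>i\<close> and \<open>k - i\<close> are at most \<open>k\<close>,
        so monotonicity bounds \<open>r k\<close> by \<open>r i\<close> in one factor and by
        \<open>r (k - i)\<close> in the other.\<close>
      have "r k ^ k = r k ^ i * r k ^ (k - i)" using i by (simp flip: power_add)
      also have "\<dots> \<le> r i ^ i * r (k - i) ^ (k - i)"
        using r i radii_pos[OF r]
        by (intro mult_mono power_mono) (auto simp: radii_def decseq_def less_imp_le)
      finally have "r k ^ k * (norm (fps_nth x i) * norm (fps_nth y (k - i))) \<le>
        r i ^ i * r (k - i) ^ (k - i) * (norm (fps_nth x i) * norm (fps_nth y (k - i)))"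
        by (intro mult_right_mono) auto
      then show "r k ^ k * (norm (fps_nth x i) * norm (fps_nth y (k - i))) \<le> ?a i * ?b (k - i)"
        by (simp add: mult_ac)
    qed
    finally show "r k ^ k * norm (fps_nth (x * y) k) \<le> (\<Sum>i\<le>k. ?a i * ?b (k - i))" .
  qed (use s assms in \<open>auto simp: sums_iff intro!: wnorm_summable r germs_mult\<close>)
  also have "\<dots> = wnorm r x * wnorm r y"
    using s by (simp add: sums_iff wnorm_def)
  finally show ?thesis .
qed

end

section \<open>Domination of rapidly decreasing sequences\<close>

text \<open>Rapid decrease means that the n-th roots of \<open>\<alpha> n\<close> tend to 0. A
  decreasing positive majorant of these roots that still tends to 0 serves as
  \<open>r\<close>.\<close>

lemma dominating_radii:
  fixes \<alpha> :: "nat \<Rightarrow> real"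
  assumes nonneg: "\<And>n. 0 \<le> \<alpha> n" and rapid: "\<And>R. R > 0 \<Longrightarrow> \<exists>M. \<forall>n. \<alpha> n * R ^ n \<le> M"
  obtains r C where "radii r" "C > 0" "\<And>n. \<alpha> n \<le> C * r n ^ n"
proof -
  \<comment> \<open>The maximum with \<open>1 / real (Suc n)\<close> keeps the radii positive where
    \<open>\<alpha>\<close> vanishes.\<close>
  define s where "s n = max (root n (\<alpha> n)) (1 / real (Suc n))" for n
  \<comment> \<open>Suprema over tails form the least decreasing majorant of \<open>s\<close>, and
    they inherit the limit 0.\<close>
  define r where "r n = (SUP j\<in>{n..}. s j)" for n
  have s_small: "eventually (\<lambda>n. s n \<le> e) sequentially" if e: "e > 0" for e
  proof -
    \<comment> \<open>Taking \<open>R = 2 / e\<close> rather than \<open>1 / e\<close> leaves a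
      spare factor \<open>(1 / 2) ^ n\<close>, which eventually absorbs \<open>M\<close>.\<close>
    obtain M where M: "\<And>n. \<alpha> n * (2 / e) ^ n \<le> M" using rapid[of "2 / e"] e by auto
    have "eventually (\<lambda>n. M * (1 / 2) ^ n < 1) sequentially"
      by (rule order_tendstoD(2)[of _ "M * 0"]) (intro tendsto_intros LIMSEQ_power_zero, auto)
    moreover have "eventually (\<lambda>n. 1 / real (Suc n) < e) sequentially"
      using order_tendstoD(2)[OF LIMSEQ_inverse_real_of_nat e] by (simp add: inverse_eq_divide)
    ultimately show ?thesis using eventually_gt_at_top[of 0]
    proof eventually_elim
      case (elim n)
      have "\<alpha> n = \<alpha> n * (2 / e) ^ n * ((1 / 2) ^ n * e ^ n)"
        using e by (simp add: power_divide)
      also have "\<dots> \<le> M * ((1 / 2) ^ n * e ^ n)"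
        using M e by (intro mult_right_mono) auto
      also have "\<dots> \<le> 1 * e ^ n"
        unfolding mult.assoc[symmetric] using elim e by (intro mult_right_mono) auto
      finally have "root n (\<alpha> n) \<le> root n (e ^ n)" using elim by simp
      also have "\<dots> = e" using elim e by (simp add: real_root_power_cancel)
      finally show ?case using elim by (simp add: s_def)
    qed
  qed
  have s_pos: "0 < s n" for n by (simp add: s_def less_max_iff_disj)
  have "s \<longlonglongrightarrow> 0"
  proof (rule order_tendstoI)
    fix a :: real assume "0 < a"
    then show "eventually (\<lambda>n. s n < a) sequentially"
      using s_small[of "a / 2"] by (auto elim: eventually_mono)
  qed (use s_pos in \<open>auto intro!: always_eventually elim: less_trans\<close>)
  then have "Bseq s" by (intro convergent_imp_Bseq convergentI)
  then have "bdd_above (range s)"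
    by (rule BseqE) (auto intro!: bdd_aboveI2 simp: abs_le_iff)
  then have bdd: "bdd_above (s ` A)" for A by (rule bdd_above_mono) auto
  have s_le_r: "s n \<le> r n" for n
    unfolding r_def by (intro cSUP_upper bdd) auto
  have r: "radii r"
    unfolding radii_def
  proof (intro conjI allI)
    show r0: "0 < r n" for n using s_pos s_le_r less_le_trans by blast
    show "decseq r"
      unfolding decseq_def r_def by (intro allI impI cSUP_subset_mono bdd) auto
    show "r \<longlonglongrightarrow> 0"
    proof (rule order_tendstoI)
      fix a :: real assume a: "0 < a"
      then obtain N where N: "\<And>n. n \<ge> N \<Longrightarrow> s n \<le> a / 2"
        using s_small[of "a / 2"] by (auto simp: eventually_sequentially)
      have "r n \<le> a / 2" if "n \<ge> N" for n
        unfolding r_def using N that by (intro cSUP_least) auto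
      then show "eventually (\<lambda>n. r n < a) sequentially"
        using a by (force simp: eventually_sequentially)
    qed (use r0 in \<open>auto intro!: always_eventually elim: less_trans\<close>)
  qed
  \<comment> \<open>At index 0 the weight is 1 and need not dominate \<open>\<alpha> 0\<close>, so
    the constant takes care of it; at all other indices the factor 1 suffices.\<close>
  have "\<alpha> n \<le> max 1 (\<alpha> 0) * r n ^ n" for n
  proof (cases "n = 0")
    case False
    have "root n (\<alpha> n) \<le> r n" using s_le_r[of n] by (simp add: s_def)
    then have "root n (\<alpha> n) ^ n \<le> r n ^ n"
      using real_root_ge_zero[OF nonneg[of n]] by (intro power_mono)
    then have "\<alpha> n \<le> 1 * r n ^ n" using False nonneg by (simp add: real_root_pow_pos2)
    also have "\<dots> \<le> max 1 (\<alpha> 0) * r n ^ n"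
      using radii_pos[OF r, of n] by (intro mult_right_mono) auto
    finally show ?thesis .
  qed simp
  then show thesis using that[OF r, of "max 1 (\<alpha> 0)"] by simp
qed


section \<open>The strong topology\<close>

definition germ_ball :: "(nat \<Rightarrow> real) \<Rightarrow> complex fps \<Rightarrow> real \<Rightarrow> complex fps set" where
  "germ_ball r b e = {c \<in> germs. wnorm r (c - b) < e}"

text \<open>By Cauchy's inequality the suprema of the Taylor coefficients over \<open>B\<close>
  decrease rapidly. Dominating them by \<open>C * r n ^ n\<close> bounds the pairing with every
  \<open>f\<close> in \<open>B\<close> by \<open>C * wnorm r x\<close>, so the radius
  \<open>e / C\<close> works at every centre.\<close>

lemma germ_ball_subset_nhd:
  assumes B: "entire_bounded B" and e: "e > 0"
  obtains r d where "radii r" "d > 0" "\<And>b. b \<in> germs \<Longrightarrow> germ_ball r b d \<subseteq> germ_nhd b B e"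
proof -
  define a where "a f n = norm (fps_nth (fps_expansion f 0) n)" for f and n :: nat
  have rapid: "\<exists>M. \<forall>f\<in>B. \<forall>n. a f n * R ^ n \<le> M" if R: "R > 0" for R
  proof -
    \<comment> \<open>One \<open>M\<close> serves all of \<open>B\<close> on the disk of radius
      \<open>R\<close>, so the coefficient bounds are uniform in \<open>f\<close>.\<close>
    obtain M where M: "\<forall>f\<in>B. \<forall>z\<in>cball 0 R. norm (f z) \<le> M"
      using B compact_cball unfolding entire_bounded_iff by metis
    have "a f n \<le> M / R ^ n" if "f \<in> B" for f n
      unfolding a_def using B M R that
      by (intro entire_coeff_bound) (auto simp: entire_bounded_def)
    then show ?thesis using R by (auto simp: field_simps intro!: exI[of _ M])
  qed
  \<comment> \<open>Adjoining the zero function keeps the supremum over a nonempty set, and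
    nonnegative, even for empty \<open>B\<close>.\<close>
  define \<alpha> where "\<alpha> n = (SUP f\<in>insert (\<lambda>z. 0) B. a f n)" for n
  have a_0: "a (\<lambda>z. 0) n = 0" for n
    by (simp add: a_def fps_expansion_def)
  have bdd: "bdd_above ((\<lambda>f. a f n) ` insert (\<lambda>z. 0) B)" for n
  proof -
    obtain M where "\<And>f n. f \<in> B \<Longrightarrow> a f n \<le> M" using rapid[of 1] by auto
    then have "bdd_above ((\<lambda>f. a f n) ` B)" by (rule bdd_aboveI2)
    then show ?thesis by simp
  qed
  have a_le: "a f n \<le> \<alpha> n" if "f \<in> insert (\<lambda>z. 0) B" for f n
    unfolding \<alpha>_def using that by (intro cSUP_upper bdd)
  have \<alpha>0: "0 \<le> \<alpha> n" for n
    using a_le[of "\<lambda>z. 0" n] by (simp add: a_0)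
  have "\<exists>M. \<forall>n. \<alpha> n * R ^ n \<le> M" if R: "R > 0" for R
  proof -
    obtain M where M: "\<And>f n. f \<in> B \<Longrightarrow> a f n * R ^ n \<le> M" using rapid[OF R] by blast
    \<comment> \<open>The bound must also cover the adjoined zero function, hence
      \<open>max 0 M\<close>.\<close>
    have "\<alpha> n \<le> max 0 M / R ^ n" for n
      unfolding \<alpha>_def
    proof (rule cSUP_least)
      fix f assume "f \<in> insert (\<lambda>z. 0) B"
      then show "a f n \<le> max 0 M / R ^ n"
        using M[of f n] R by (auto simp: a_0 field_simps)
    qed auto
    then show ?thesis using R by (auto simp: field_simps intro!: exI[of _ "max 0 M"])
  qed
  from dominating_radii[OF \<alpha>0 this] obtain r C
    where r: "radii r" and C: "C > 0" "\<And>n. \<alpha> n \<le> C * r n ^ n" by blast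
  have "norm (dual_pairing x f) < e" if f: "f \<in> B" and x: "x \<in> germs" "wnorm r x < e / C" for f x
  proof -
    have le: "norm (fps_nth (fps_expansion f 0) n * fps_nth x n) \<le> C * (r n ^ n * norm (fps_nth x n))" for n
    proof -
      have "a f n * norm (fps_nth x n) \<le> C * r n ^ n * norm (fps_nth x n)"
        using a_le[of f n] C(2)[of n] f by (intro mult_right_mono) auto
      then show ?thesis by (simp add: a_def norm_mult mult_ac)
    qed
    have sm: "summable (\<lambda>n. C * (r n ^ n * norm (fps_nth x n)))"
      by (intro summable_mult wnorm_summable r x)
    have "norm (dual_pairing x f) \<le> (\<Sum>n. C * (r n ^ n * norm (fps_nth x n)))"
      unfolding dual_pairing_def by (rule norm_suminf_le[OF le sm])
    also have "\<dots> = C * wnorm r x"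
      unfolding wnorm_def by (intro suminf_mult wnorm_summable r x)
    also have "\<dots> < e" using x(2) C(1) by (simp add: field_simps)
    finally show ?thesis .
  qed
  then show thesis
    using C(1) e by (intro that[OF r, of "e / C"]) (auto simp: germ_ball_def germ_nhd_def germs_diff)
qed

text \<open>Only one Taylor coefficient of a monomial survives, and \<open>c\<close> comes out by
  linearity. This is how neighbourhoods in the strong topology control individual
  coefficients.\<close>

lemma dual_pairing_monomial:
  assumes "x \<in> germs"
  shows "dual_pairing x (\<lambda>z. c * z ^ n) = c * fps_nth x n"
proof -
  have "fps_nth (fps_expansion (\<lambda>z::complex. z ^ n) 0) k = (if k = n then 1 else 0)" for k
    using fps_nth_fps_expansion[OF has_fps_expansion_power[OF has_fps_expansion_fps_X], of n k]
    by (simp add: fps_expansion_def)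
  then have "dual_pairing x (\<lambda>z. z ^ n) = (\<Sum>k. if k = n then fps_nth x k else 0)"
    unfolding dual_pairing_def by (intro arg_cong[of _ _ suminf]) auto
  also have "\<dots> = fps_nth x n"
    using sums_single[of n "fps_nth x"] by (simp add: sums_iff)
  finally have "dual_pairing x (\<lambda>z. z ^ n) = fps_nth x n" .
  moreover have "(\<lambda>z. z ^ n) \<in> entire_functions"
    by (auto simp: entire_functions_def intro!: holomorphic_intros)
  ultimately show ?thesis
    using continuous_functional_dual_pairing[OF assms] by (simp add: continuous_functional_def)
qed

text \<open>The monomials \<open>(2 r\<^sub>n)\<^sup>n z\<^sup>n\<close> form a bounded set; the factor \<open>2\<^sup>n\<close> turns the
  supremum of the weighted coefficients into a bound for their sum.\<close>

lemma germ_nhd_subset_ball: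
  assumes r: "radii r" and e: "e > 0"
  obtains B d where "entire_bounded B" "d > 0" "\<And>b. b \<in> germs \<Longrightarrow> germ_nhd b B d \<subseteq> germ_ball r b e"
proof -
  define m where "m n = (\<lambda>z::complex. of_real ((2 * r n) ^ n) * z ^ n)" for n
  have "entire_bounded (range m)"
    unfolding entire_bounded_iff
  proof (intro conjI allI impI)
    show "range m \<subseteq> entire_functions"
      by (auto simp: m_def entire_functions_def intro!: holomorphic_intros)
    fix K :: "complex set" assume "compact K"
    then obtain R where R: "R > 0" "\<And>z. z \<in> K \<Longrightarrow> norm z \<le> R"
      using compact_imp_bounded bounded_pos by metis
    \<comment> \<open>The doubled sequence is again of type \<open>radii\<close>, so the terms on
      the disk of radius \<open>R\<close> are summable and hence bounded.\<close>
    obtain M where M: "\<And>n. norm ((2 * r n) ^ n * R ^ n) \<le> M"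
      using summable_imp_Bseq[OF radii_summable[OF radii_double[OF r] R(1)]]
      by (rule BseqE) blast
    have "norm (m n z) \<le> M" if "z \<in> K" for n z
    proof -
      have "norm (m n z) = (2 * r n) ^ n * norm z ^ n"
        unfolding m_def norm_mult norm_of_real norm_power using radii_pos[OF r, of n] by simp
      also have "\<dots> \<le> (2 * r n) ^ n * R ^ n"
        using R that radii_pos[OF r, of n] by (intro mult_left_mono power_mono) auto
      also have "\<dots> \<le> M" using M[of n] by simp
      finally show ?thesis .
    qed
    then show "\<exists>M. \<forall>f\<in>range m. \<forall>z\<in>K. norm (f z) \<le> M" by blast
  qed
  \<comment> \<open>The bound \<open>e / 4\<close> on each pairing sums to \<open>e / 2\<close> in
    the norm, which leaves the inequality strict.\<close>
  moreover have "wnorm r x < e"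
    if x: "x \<in> germs" "\<And>n. norm (dual_pairing x (m n)) < e / 4" for x
  proof -
    have le: "r n ^ n * norm (fps_nth x n) \<le> e / 4 * (1 / 2) ^ n" for n
      using x(2)[of n] radii_pos[OF r, of n]
      unfolding m_def dual_pairing_monomial[OF x(1)] norm_mult norm_of_real
      by (simp add: power_mult_distrib power_divide field_simps)
    have g: "(\<lambda>n. e / 4 * (1 / 2) ^ n) sums (e / 4 * 2)"
      using sums_mult[OF geometric_sums[of "1 / 2 :: real"], of "e / 4"] by simp
    have "wnorm r x \<le> e / 4 * 2"
      unfolding wnorm_def sums_unique[OF g]
      by (intro suminf_le le wnorm_summable r x sums_summable[OF g])
    then show ?thesis using e by simp
  qed
  ultimately show thesis
    using e by (intro that[of "range m" "e / 4"]) (auto simp: germ_ball_def germ_nhd_def germs_diff)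
qed

text \<open>The two preceding inclusions show that both kinds of neighbourhoods generate the same
  topology. From here on the strong topology is handled through the norms \<open>wnorm r\<close>
  alone.\<close>

lemma openin_germ_topology_ball:
  "openin germ_topology U \<longleftrightarrow> U \<subseteq> germs \<and>
     (\<forall>b\<in>U. \<exists>r e. radii r \<and> e > 0 \<and> germ_ball r b e \<subseteq> U)"
proof -
  have "(\<exists>B e. entire_bounded B \<and> e > 0 \<and> germ_nhd b B e \<subseteq> U) \<longleftrightarrow>
      (\<exists>r e. radii r \<and> e > 0 \<and> germ_ball r b e \<subseteq> U)" if "b \<in> germs" for b
  proof
    assume "\<exists>B e. entire_bounded B \<and> e > 0 \<and> germ_nhd b B e \<subseteq> U"
    then obtain B e where B: "entire_bounded B" "e > 0" "germ_nhd b B e \<subseteq> U" by blast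
    show "\<exists>r e. radii r \<and> e > 0 \<and> germ_ball r b e \<subseteq> U"
      using germ_ball_subset_nhd[OF B(1,2)] B(3) that by (metis subset_trans)
  next
    assume "\<exists>r e. radii r \<and> e > 0 \<and> germ_ball r b e \<subseteq> U"
    then obtain r e where r: "radii r" "e > 0" "germ_ball r b e \<subseteq> U" by blast
    show "\<exists>B e. entire_bounded B \<and> e > 0 \<and> germ_nhd b B e \<subseteq> U"
      using germ_nhd_subset_ball[OF r(1,2)] r(3) that by (metis subset_trans)
  qed
  then show ?thesis unfolding openin_germ_topology by blast
qed

lemma openin_germ_ball:
  assumes r: "radii r" and b: "b \<in> germs"
  shows "openin germ_topology (germ_ball r b e)"
  unfolding openin_germ_topology_ball
proof (intro conjI ballI)
  fix c assume c: "c \<in> germ_ball r b e"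
  have "germ_ball r c (e - wnorm r (c - b)) \<subseteq> germ_ball r b e"
    using wnorm_triangle[OF r, of _ c b] b c by (fastforce simp: germ_ball_def)
  then show "\<exists>r' e'. radii r' \<and> e' > 0 \<and> germ_ball r' c e' \<subseteq> germ_ball r b e"
    using r c by (intro exI[of _ r] exI[of _ "e - wnorm r (c - b)"]) (auto simp: germ_ball_def)
qed (auto simp: germ_ball_def)

lemma centre_in_germ_ball: "b \<in> germs \<Longrightarrow> e > 0 \<Longrightarrow> b \<in> germ_ball r b e"
  by (simp add: germ_ball_def)

text \<open>An epsilon criterion that tests one norm at a time. The source \<open>X\<close> stays
  arbitrary so that it applies to product topologies and to the subspace of units.\<close>

lemma continuous_map_germ_topologyI:
  assumes "\<And>x. x \<in> topspace X \<Longrightarrow> f x \<in> germs"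
    and V: "\<And>x r e. x \<in> topspace X \<Longrightarrow> radii r \<Longrightarrow> e > 0 \<Longrightarrow>
      \<exists>V. openin X V \<and> x \<in> V \<and> (\<forall>y\<in>V. wnorm r (f y - f x) < e)"
  shows "continuous_map X germ_topology f"
  unfolding continuous_map_def
proof (intro conjI allI impI)
  fix U assume U: "openin germ_topology U"
  show "openin X {x \<in> topspace X. f x \<in> U}"
  proof (subst openin_subopen, intro ballI)
    fix x assume x: "x \<in> {x \<in> topspace X. f x \<in> U}"
    then obtain r e where r: "radii r" "e > 0" "germ_ball r (f x) e \<subseteq> U"
      using U unfolding openin_germ_topology_ball by blast
    obtain V where V: "openin X V" "x \<in> V" "\<And>y. y \<in> V \<Longrightarrow> wnorm r (f y - f x) < e"
      using V[of x r e] x r by blast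
    have "V \<subseteq> {x \<in> topspace X. f x \<in> U}"
      using V(3) r(3) assms(1) openin_subset[OF V(1)] by (auto simp: germ_ball_def)
    then show "\<exists>T. openin X T \<and> x \<in> T \<and> T \<subseteq> {x \<in> topspace X. f x \<in> U}" using V by blast
  qed
qed (use assms in auto)

section \<open>Continuity of the algebraic operations\<close>

lemma continuous_map_germ_add:
  "continuous_map (prod_topology germ_topology germ_topology) germ_topology (\<lambda>(x, y). x + y)"
proof (rule continuous_map_germ_topologyI)
  fix p r and e :: real
  assume p: "p \<in> topspace (prod_topology germ_topology germ_topology)" and r: "radii r" and e: "e > 0"
  obtain a b where ab: "p = (a, b)" "a \<in> germs" "b \<in> germs" using p by auto
  have "wnorm r (x + y - (a + b)) < e" if "x \<in> germ_ball r a (e / 2)" "y \<in> germ_ball r b (e / 2)" for x y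
  proof -
    have "wnorm r ((x - a) + (y - b)) \<le> wnorm r (x - a) + wnorm r (y - b)"
      using that ab by (intro wnorm_add r germs_diff) (auto simp: germ_ball_def)
    then show ?thesis using that by (simp add: germ_ball_def add_diff_add)
  qed
  then show "\<exists>V. openin (prod_topology germ_topology germ_topology) V \<and> p \<in> V \<and>
      (\<forall>q\<in>V. wnorm r ((case q of (x, y) \<Rightarrow> x + y) - (case p of (x, y) \<Rightarrow> x + y)) < e)"
    using ab r e
    by (intro exI[of _ "germ_ball r a (e / 2) \<times> germ_ball r b (e / 2)"])
      (auto simp: openin_prod_Times_iff openin_germ_ball centre_in_germ_ball)
qed (auto simp: germs_add)

text \<open>The numerical core of continuity of a bilinear map at a point: \<open>s\<close> and
  \<open>t\<close> are the sizes of the increments, \<open>a\<close> and \<open>b\<close> those of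
  the point. It serves products and scalar multiples alike.\<close>

lemma mult_increment_bound:
  fixes a b e :: real
  assumes "0 \<le> a" "0 \<le> b" "0 < e"
  obtains d where "0 < d"
    "\<And>s t. 0 \<le> s \<Longrightarrow> s < d \<Longrightarrow> 0 \<le> t \<Longrightarrow> t < d \<Longrightarrow> s * t + a * t + s * b < e"
proof -
  \<comment> \<open>As \<open>d\<close> is at most 1, the quadratic term is at most \<open>d\<close>
    and the whole sum at most \<open>d * (a + b + 1)\<close>; the 2 in the denominator makes the
    comparison with \<open>e\<close> strict.\<close>
  define d where "d = min 1 (e / (a + b + 2))"
  have pos: "a + b + 2 > 0" using assms by simp
  have "d \<le> e / (a + b + 2)" by (simp add: d_def)
  then have d: "0 < d" "d \<le> 1" "d * (a + b + 2) \<le> e"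
    using assms pos unfolding pos_le_divide_eq[OF pos] by (simp_all add: d_def)
  have "s * t + a * t + s * b < e" if "0 \<le> s" "s < d" "0 \<le> t" "t < d" for s t
  proof -
    have "s * t \<le> d * 1"
      using that d by (intro mult_mono) auto
    moreover have "a * t \<le> a * d" "s * b \<le> d * b"
      using that d assms by (auto intro!: mult_mono)
    ultimately have "s * t + a * t + s * b \<le> d * (a + b + 1)" by (simp add: algebra_simps)
    also have "\<dots> < d * (a + b + 2)" using d by simp
    finally show ?thesis using d by simp
  qed
  then show thesis using that d by blast
qed

text \<open>Submultiplicativity lets the same weights serve the product and both factors, so joint
  continuity follows as in a normed algebra.\<close>

lemma continuous_map_germ_mult:
  "continuous_map (prod_topology germ_topology germ_topology) germ_topology (\<lambda>(x, y). x * y)"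
proof (rule continuous_map_germ_topologyI)
  fix p r and e :: real
  assume p: "p \<in> topspace (prod_topology germ_topology germ_topology)" and r: "radii r" and e: "e > 0"
  obtain a b where ab: "p = (a, b)" "a \<in> germs" "b \<in> germs" using p by auto
  obtain d where d: "0 < d" "\<And>s t. 0 \<le> s \<Longrightarrow> s < d \<Longrightarrow> 0 \<le> t \<Longrightarrow> t < d \<Longrightarrow>
      s * t + wnorm r a * t + s * wnorm r b < e"
    using mult_increment_bound[OF wnorm_nonneg[OF r ab(2)] wnorm_nonneg[OF r ab(3)] e] by blast
  have "wnorm r (x * y - a * b) < e" if "x \<in> germ_ball r a d" "y \<in> germ_ball r b d" for x y
  proof -
    let ?u = "x - a" and ?v = "y - b"
    have g: "?u \<in> germs" "?v \<in> germs" and small: "wnorm r ?u < d" "wnorm r ?v < d"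
      using that ab by (auto simp: germ_ball_def germs_diff)
    have "x * y - a * b = ?u * ?v + a * ?v + ?u * b" by (simp add: algebra_simps)
    also have "wnorm r \<dots> \<le> wnorm r (?u * ?v) + wnorm r (a * ?v) + wnorm r (?u * b)"
      using g ab by (intro order_trans[OF wnorm_add[OF r]] add_right_mono wnorm_add r germs_add germs_mult)
    also have "\<dots> \<le> wnorm r ?u * wnorm r ?v + wnorm r a * wnorm r ?v + wnorm r ?u * wnorm r b"
      using g ab by (intro add_mono wnorm_mult r)
    also have "\<dots> < e" using g small by (intro d(2) wnorm_nonneg r)
    finally show ?thesis .
  qed
  then show "\<exists>V. openin (prod_topology germ_topology germ_topology) V \<and> p \<in> V \<and>
      (\<forall>q\<in>V. wnorm r ((case q of (x, y) \<Rightarrow> x * y) - (case p of (x, y) \<Rightarrow> x * y)) < e)"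
    using ab r d(1)
    by (intro exI[of _ "germ_ball r a d \<times> germ_ball r b d"])
      (auto simp: openin_prod_Times_iff openin_germ_ball centre_in_germ_ball)
qed (auto simp: germs_mult)

lemma continuous_map_germ_scale:
  "continuous_map (prod_topology euclidean germ_topology) germ_topology (\<lambda>(c, x). germ_scale c x)"
proof (rule continuous_map_germ_topologyI)
  fix p r and e :: real
  assume p: "p \<in> topspace (prod_topology (euclidean :: complex topology) germ_topology)"
    and r: "radii r" and e: "e > 0"
  obtain a b where ab: "p = (a, b)" "b \<in> germs" using p by auto
  obtain d where d: "0 < d" "\<And>s t. 0 \<le> s \<Longrightarrow> s < d \<Longrightarrow> 0 \<le> t \<Longrightarrow> t < d \<Longrightarrow>
      s * t + norm a * t + s * wnorm r b < e"
    using mult_increment_bound[OF norm_ge_zero wnorm_nonneg[OF r ab(2)] e] by blast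
  have "wnorm r (germ_scale c x - germ_scale a b) < e" if "c \<in> ball a d" "x \<in> germ_ball r b d" for c x
  proof -
    let ?u = "c - a" and ?v = "x - b"
    have g: "?v \<in> germs" and small: "norm ?u < d" "wnorm r ?v < d"
      using that ab by (auto simp: germ_ball_def germs_diff dist_norm norm_minus_commute)
    have "germ_scale c x - germ_scale a b = germ_scale ?u ?v + germ_scale a ?v + germ_scale ?u b"
      by (simp add: fps_eq_iff algebra_simps)
    also have "wnorm r \<dots> \<le> wnorm r (germ_scale ?u ?v) + wnorm r (germ_scale a ?v) + wnorm r (germ_scale ?u b)"
      using g ab by (intro order_trans[OF wnorm_add[OF r]] add_right_mono wnorm_add r germs_add germs_scale)
    also have "\<dots> = norm ?u * wnorm r ?v + norm a * wnorm r ?v + norm ?u * wnorm r b"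
      using g ab r by (simp add: wnorm_scale)
    also have "\<dots> < e" using g small by (intro d(2) wnorm_nonneg r norm_ge_zero)
    finally show ?thesis .
  qed
  then show "\<exists>V. openin (prod_topology (euclidean :: complex topology) germ_topology) V \<and> p \<in> V \<and>
      (\<forall>q\<in>V. wnorm r ((case q of (c, x) \<Rightarrow> germ_scale c x) - (case p of (c, x) \<Rightarrow> germ_scale c x)) < e)"
    using ab r d(1)
    by (intro exI[of _ "ball a d \<times> germ_ball r b d"])
      (auto simp: openin_prod_Times_iff openin_germ_ball centre_in_germ_ball simp flip: open_openin)
qed (auto simp: germs_scale)

lemma vector_space_germ_scale: "vector_space germ_scale"
  by unfold_locales (auto simp: fps_eq_iff algebra_simps)

lemma topological_vector_space_germs: "topological_vector_space germ_scale germ_topology"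
proof -
  have "module germ_scale"
    using vector_space_germ_scale by (simp add: module_iff_vector_space)
  then have "module.subspace germ_scale germs"
    by (simp add: module.subspace_def germs_add germs_scale)
  then show ?thesis
    by (simp add: topological_vector_space_def vector_space_germ_scale
        continuous_map_germ_add continuous_map_germ_scale)
qed

lemma topological_algebra_germs: "topological_algebra germ_scale germ_topology"
  by (simp add: topological_algebra_def topological_vector_space_germs continuous_map_germ_mult
      germ_scale_def mult_ac)


section \<open>Inversion\<close>

text \<open>The weight at index 0 is 1, so within distance \<open>norm (fps_nth f 0)\<close> of
  \<open>f\<close> the constant coefficient cannot reach 0.\<close>

lemma openin_germ_units: "openin germ_topology germ_units"
  unfolding openin_germ_topology_ball
proof (intro conjI ballI)
  fix f assume "f \<in> germ_units"
  then have f: "f \<in> germs" "fps_nth f 0 \<noteq> 0"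
    using germ_units_iff by (auto simp: germ_units_def)
  \<comment> \<open>Any weights will do; the zero sequence merely shows that some exist.\<close>
  obtain r C where r: "radii r" using dominating_radii[of "\<lambda>n. 0"] by auto
  have "g \<in> germ_units" if g: "g \<in> germ_ball r f (norm (fps_nth f 0))" for g
  proof -
    have "norm (fps_nth (g - f) 0) \<le> wnorm r (g - f)"
      using wnorm_coeff[OF r, of "g - f" 0] f g by (simp add: germ_ball_def germs_diff)
    then have "fps_nth g 0 \<noteq> 0" using g by (auto simp: germ_ball_def)
    then show ?thesis using g by (simp add: germ_ball_def germ_units_iff)
  qed
  then show "\<exists>r e. radii r \<and> e > 0 \<and> germ_ball r f e \<subseteq> germ_units"
    using r f by (intro exI[of _ r] exI[of _ "norm (fps_nth f 0)"]) auto
qed (auto simp: germ_units_def)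

text \<open>The difference \<open>D\<close> of the inverses equals
  \<open>inverse f * (f - g) * inverse g\<close>. Bounding the last factor through \<open>D\<close>
  itself gives an inequality with \<open>D\<close> on both sides, and for \<open>g\<close> close to
  \<open>f\<close> the right-hand occurrence is absorbed.\<close>

lemma continuous_map_germ_inverse:
  "continuous_map (subtopology germ_topology germ_units) germ_topology germ_inverse"
proof (rule continuous_map_germ_topologyI)
  have units: "x \<in> germs" "fps_nth x 0 \<noteq> 0" "inverse x \<in> germs" "germ_inverse x = inverse x"
    if "x \<in> germ_units" for x
    using that germ_units_iff germs_inverse germ_inverse_eq by (auto simp: germ_units_def)
  then show "germ_inverse x \<in> germs" if "x \<in> topspace (subtopology germ_topology germ_units)" for x
    using that by simp
  fix f r and e :: real
  assume f: "f \<in> topspace (subtopology germ_topology germ_units)" and r: "radii r" and e: "e > 0"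
  then have fu: "f \<in> germ_units" by simp
  define a where "a = wnorm r (inverse f)"
  have a: "a \<ge> 0" using units[OF fu] by (simp add: a_def wnorm_nonneg r)
  \<comment> \<open>The first entry gives \<open>a * d \<le> 1 / 2\<close>, for the absorption; the
    second gives \<open>a\<^sup>2 * d < e / 2\<close>, for the remaining term. The added 1 keeps the
    denominators positive.\<close>
  define d where "d = min (1 / (2 * (a + 1))) (e / (2 * (a\<^sup>2 + 1)))"
  have d: "d > 0" using a e by (simp add: d_def add_nonneg_pos)
  have "a * d \<le> a * (1 / (2 * (a + 1)))"
    using a by (intro mult_left_mono) (simp_all add: d_def)
  also have "\<dots> \<le> 1 / 2" using a by (simp add: field_simps)
  finally have ad: "a * d \<le> 1 / 2" .
  have "a\<^sup>2 * d \<le> a\<^sup>2 * (e / (2 * (a\<^sup>2 + 1)))"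
    by (intro mult_left_mono) (simp_all add: d_def)
  also have "\<dots> < e / 2"
    using e by (simp add: field_simps add_pos_nonneg add_nonneg_pos)
  finally have aad: "a\<^sup>2 * d < e / 2" .
  have "wnorm r (inverse g - inverse f) < e" if g: "g \<in> germ_ball r f d" "g \<in> germ_units" for g
  proof -
    let ?D = "inverse g - inverse f"
    note gu = units[OF g(2)] and fu = units[OF fu]
    have D: "?D \<in> germs" and fg: "f - g \<in> germs" using gu fu by (auto intro: germs_diff)
    have \<delta>: "wnorm r (f - g) \<le> d"
      using g wnorm_minus_commute[of r f g] by (simp add: germ_ball_def)
    have "inverse f * (f - g) * inverse g = (f * inverse f) * inverse g - inverse f * (g * inverse g)"
      by (simp add: algebra_simps)
    also have "\<dots> = ?D" using gu fu by (simp add: inverse_mult_eq_1')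
    finally have "wnorm r ?D = wnorm r (inverse f * (f - g) * inverse g)" by simp
    also have "\<dots> \<le> wnorm r (inverse f * (f - g)) * wnorm r (inverse g)"
      by (intro wnorm_mult r germs_mult gu fu fg)
    also have "\<dots> \<le> (a * d) * (wnorm r ?D + a)"
    proof (rule mult_mono)
      have "wnorm r (inverse f * (f - g)) \<le> a * wnorm r (f - g)"
        unfolding a_def by (intro wnorm_mult r fu fg)
      also have "\<dots> \<le> a * d" using a \<delta> by (rule mult_left_mono[rotated])
      finally show "wnorm r (inverse f * (f - g)) \<le> a * d" .
      \<comment> \<open>No bound on \<open>inverse g\<close> is known yet, so it is written as
        \<open>D\<close> plus \<open>inverse f\<close>.\<close>
      show "wnorm r (inverse g) \<le> wnorm r ?D + a"
        using wnorm_add[OF r D fu(3)] by (simp add: a_def)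
    qed (use a d gu r in \<open>auto simp: wnorm_nonneg\<close>)
    also have "\<dots> = (a * d) * wnorm r ?D + a\<^sup>2 * d"
      by (simp add: algebra_simps power2_eq_square)
    also have "\<dots> \<le> 1 / 2 * wnorm r ?D + a\<^sup>2 * d"
      using ad wnorm_nonneg[OF r D] by (intro add_right_mono mult_right_mono)
    \<comment> \<open>Half of the norm of \<open>D\<close> moves to the left, leaving it below
      \<open>e\<close>.\<close>
    finally show ?thesis using aad by simp
  qed
  then show "\<exists>V. openin (subtopology germ_topology germ_units) V \<and> f \<in> V \<and>
      (\<forall>g\<in>V. wnorm r (germ_inverse g - germ_inverse f) < e)"
    using fu units r d
    by (intro exI[of _ "germ_units \<inter> germ_ball r f d"])
      (auto simp: openin_subtopology_Int2 openin_germ_ball centre_in_germ_ball)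
qed


section \<open>Nuclearity\<close>

text \<open>Every neighbourhood of 0 contains a ball of a single norm, and such balls are
  convex.\<close>

lemma locally_convex_germs: "locally_convex_space germ_scale germ_topology"
  unfolding locally_convex_space_def
proof (intro conjI allI impI topological_vector_space_germs)
  fix U assume U: "openin germ_topology U \<and> 0 \<in> U"
  then obtain r e where r: "radii r" and e: "e > 0" and sub: "germ_ball r 0 e \<subseteq> U"
    unfolding openin_germ_topology_ball by blast
  have "convex_wrt germ_scale (germ_ball r 0 e)"
    unfolding convex_wrt_def
  proof (intro ballI)
    fix x y and t :: real
    assume x: "x \<in> germ_ball r 0 e" and y: "y \<in> germ_ball r 0 e" and t: "t \<in> {0..1}"
    have g: "x \<in> germs" "y \<in> germs" and w: "wnorm r x < e" "wnorm r y < e"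
      using x y by (auto simp: germ_ball_def)
    have n: "norm (of_real t :: complex) = t" "norm (of_real (1 - t) :: complex) = 1 - t"
      using t by (simp_all only: norm_of_real) auto
    have "wnorm r (germ_scale (of_real t) x + germ_scale (of_real (1 - t)) y) \<le>
        wnorm r (germ_scale (of_real t) x) + wnorm r (germ_scale (of_real (1 - t)) y)"
      by (intro wnorm_add r germs_scale g)
    also have "\<dots> = t * wnorm r x + (1 - t) * wnorm r y"
      by (simp only: wnorm_scale[OF r] g n)
    also have "\<dots> < e" using t w by (intro convex_bound_lt) auto
    finally show "germ_scale (of_real t) x + germ_scale (of_real (1 - t)) y \<in> germ_ball r 0 e"
      using g by (simp add: germ_ball_def germs_add germs_scale)
  qed
  then show "\<exists>W. openin germ_topology W \<and> 0 \<in> W \<and> convex_wrt germ_scale W \<and> W \<subseteq> U"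
    using sub openin_germ_ball[OF r, of 0 e] centre_in_germ_ball[of 0 e r] e
    by (intro exI[of _ "germ_ball r 0 e"]) auto
qed

section \<open>Continuous seminorms and the weighted norms\<close>

text \<open>Supplies the dominating seminorm in the definition of nuclearity. Continuity is the
  reverse triangle inequality.\<close>

lemma continuous_seminorm_wnorm:
  assumes r: "radii r" and C: "C > 0"
  shows "continuous_seminorm germ_scale germ_topology (\<lambda>x. C * wnorm r x)"
  unfolding continuous_seminorm_def topspace_germ_topology
proof (intro conjI ballI allI)
  show "continuous_map germ_topology euclideanreal (\<lambda>x. C * wnorm r x)"
    unfolding continuous_map_def
  proof (intro conjI allI impI)
    fix W assume W: "openin euclideanreal W"
    show "openin germ_topology {x \<in> topspace germ_topology. C * wnorm r x \<in> W}"
      unfolding openin_germ_topology_ball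
    proof (intro conjI ballI)
      fix x assume x: "x \<in> {x \<in> topspace germ_topology. C * wnorm r x \<in> W}"
      then obtain e where e: "e > 0" "ball (C * wnorm r x) e \<subseteq> W"
        using W open_contains_ball by (metis (lifting) mem_Collect_eq open_openin)
      have "C * wnorm r y \<in> W" if y: "y \<in> germ_ball r x (e / C)" for y
      proof -
        have g: "x \<in> germs" "y \<in> germs" "wnorm r (y - x) < e / C"
          using x y by (auto simp: germ_ball_def)
        have "wnorm r y \<le> wnorm r (y - x) + wnorm r x" "wnorm r x \<le> wnorm r (y - x) + wnorm r y"
          using wnorm_add[OF r, of "y - x" x] wnorm_add[OF r, of "x - y" y]
            wnorm_minus_commute[of r x y] g by (simp_all add: germs_diff)
        then have "\<bar>wnorm r x - wnorm r y\<bar> < e / C" using g(3) by linarith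
        then have "C * \<bar>wnorm r x - wnorm r y\<bar> < e" using C by (simp add: field_simps)
        then have "\<bar>C * wnorm r x - C * wnorm r y\<bar> < e"
          using C by (simp add: abs_mult flip: right_diff_distrib)
        then show ?thesis using e(2) by (auto simp: dist_real_def)
      qed
      then show "\<exists>r' e'. radii r' \<and> e' > 0 \<and>
          germ_ball r' x e' \<subseteq> {x \<in> topspace germ_topology. C * wnorm r x \<in> W}"
        using r e C by (intro exI[of _ r] exI[of _ "e / C"]) (auto simp: germ_ball_def)
    qed auto
  qed auto
  show "C * wnorm r (x + y) \<le> C * wnorm r x + C * wnorm r y" if "x \<in> germs" "y \<in> germs" for x y
    using wnorm_add[OF r that] C by (simp flip: distrib_left)
qed (use r C in \<open>auto simp: wnorm_nonneg wnorm_scale\<close>)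

text \<open>The open set where \<open>p\<close> is below 1 contains a ball of some
  \<open>wnorm r\<close>, and homogeneity turns this inclusion into a global estimate.\<close>

lemma continuous_seminorm_le_wnorm:
  assumes p: "continuous_seminorm germ_scale germ_topology p"
  obtains r C where "radii r" "C > 0" "\<And>x. x \<in> germs \<Longrightarrow> p x \<le> C * wnorm r x"
proof -
  have scale: "p (germ_scale c x) = norm c * p x" if "x \<in> germs" for c x
    using p that by (simp add: continuous_seminorm_def)
  have "openin germ_topology {x \<in> germs. p x \<in> {..<1}}"
    using p open_lessThan[of "1::real"]
    unfolding continuous_seminorm_def continuous_map_def topspace_germ_topology
    by (metis open_openin)
  moreover have "p 0 = 0" using scale[of 0 0] by (simp add: germ_scale_def)
  then have "0 \<in> {x \<in> germs. p x \<in> {..<1}}" by simp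
  ultimately obtain r e where r: "radii r" and e: "e > 0"
    and sub: "germ_ball r 0 e \<subseteq> {x \<in> germs. p x \<in> {..<1}}"
    unfolding openin_germ_topology_ball by meson
  have "p x \<le> 2 / e * wnorm r x" if x: "x \<in> germs" for x
  \<comment> \<open>The slack \<open>d\<close> makes the scaling factor \<open>t\<close> positive
    for \<open>x = 0\<close> too; \<open>x\<close> divided by \<open>t\<close> then lies in the
    ball, where \<open>p\<close> is below 1.\<close>
  proof (rule field_le_epsilon)
    fix d :: real assume d: "d > 0"
    define t where "t = 2 / e * wnorm r x + d"
    have t: "t > 0" using wnorm_nonneg[OF r x] e d by (simp add: t_def add_nonneg_pos)
    have n: "norm (of_real (1 / t) :: complex) = 1 / t" using t by (simp only: norm_of_real) simp
    have "wnorm r x < e * t"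
      using wnorm_nonneg[OF r x] e d by (simp add: t_def algebra_simps add_pos_nonneg)
    then have "germ_scale (of_real (1 / t)) x \<in> germ_ball r 0 e"
      using x t by (simp add: germ_ball_def germs_scale wnorm_scale[OF r x] n divide_less_eq del: of_real_divide)
    then have "1 / t * p x < 1" using sub scale[OF x] n by fastforce
    then have "p x \<le> t" using t by (simp add: divide_less_eq)
    then show "p x \<le> 2 / e * wnorm r x + d" unfolding t_def .
  qed
  then show thesis using r e by (intro that[of r "2 / e"]) auto
qed

section \<open>Nuclear representation by monomials\<close>

lemma wnorm_monomial: "wnorm r (fps_X ^ n) = r n ^ n"
proof -
  have "(\<lambda>k. if k = n then r k ^ k else 0) sums r n ^ n" by (rule sums_single)
  moreover have "r k ^ k * norm (fps_nth (fps_X ^ n :: complex fps) k) = (if k = n then r k ^ k else 0)" for k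
    by simp
  ultimately show ?thesis by (simp add: wnorm_def sums_iff)
qed

text \<open>Subtracting the partial sum deletes the first \<open>N\<close> coefficients, so the norm
  of the remainder is the tail of a convergent series.\<close>

lemma wnorm_remainder_tendsto_0:
  assumes r: "radii r" and x: "x \<in> germs"
  shows "(\<lambda>N. wnorm r (x - (\<Sum>n<N. germ_scale (fps_nth x n) (fps_X ^ n)))) \<longlonglongrightarrow> 0"
proof -
  let ?t = "\<lambda>n. r n ^ n * norm (fps_nth x n)"
  have sm: "summable ?t" by (rule wnorm_summable[OF r x])
  have "wnorm r (x - (\<Sum>n<N. germ_scale (fps_nth x n) (fps_X ^ n))) = wnorm r x - (\<Sum>n<N. ?t n)" for N
  proof -
    define y where "y = x - (\<Sum>n<N. germ_scale (fps_nth x n) (fps_X ^ n))"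
    have y: "fps_nth y k = (if k < N then 0 else fps_nth x k)" for k
      by (simp add: y_def fps_sum_nth if_distrib[of "\<lambda>z. fps_nth x _ * z"] sum.delta' cong: if_cong)
    have "y \<in> germs" unfolding y_def by (intro germs_diff germs_sum germs_scale germs_closed x)
    from suminf_minus_initial_segment[OF wnorm_summable[OF r this], of N]
    have "(\<Sum>n. ?t (n + N)) = wnorm r y" by (simp add: wnorm_def y)
    then show ?thesis
      using suminf_minus_initial_segment[OF sm, of N] by (simp add: wnorm_def flip: y_def)
  qed
  moreover have "(\<lambda>N. wnorm r x - (\<Sum>n<N. ?t n)) \<longlonglongrightarrow> wnorm r x - wnorm r x"
    using summable_LIMSEQ[OF sm] by (intro tendsto_intros) (simp add: wnorm_def)
  ultimately show ?thesis by simp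
qed

text \<open>A real supremum is informative only over a nonempty bounded set: the point 0 provides
  the former and \<open>K\<close> the latter.\<close>

lemma functional_norm_bounds:
  assumes "0 \<in> V" "q 0 \<le> 1" and le: "\<And>x. x \<in> V \<Longrightarrow> q x \<le> 1 \<Longrightarrow> norm (u x) \<le> K"
  shows "0 \<le> functional_norm V q u" "functional_norm V q u \<le> K"
proof -
  have "bdd_above ((\<lambda>x. norm (u x)) ` {x \<in> V. q x \<le> 1})"
    using le by (auto intro!: bdd_aboveI2)
  then have "norm (u 0) \<le> functional_norm V q u"
    unfolding functional_norm_def using assms by (intro cSUP_upper) auto
  then show "0 \<le> functional_norm V q u" using norm_ge_zero order_trans by blast
  show "functional_norm V q u \<le> K"
    unfolding functional_norm_def using assms by (intro cSUP_least) auto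
qed

text \<open>The n-th coefficient functional has norm at most \<open>1 / (C * (2 * r n) ^ n)\<close>
  for the doubled radii, while \<open>p\<close> of the n-th monomial is at most
  \<open>C * r n ^ n\<close>. The products are bounded by \<open>(1 / 2) ^ n\<close>.\<close>

lemma nuclear_canonical_map_germs:
  assumes p: "continuous_seminorm germ_scale germ_topology p" and r: "radii r" and C: "C > 0"
    and p_le: "\<And>x. x \<in> germs \<Longrightarrow> p x \<le> C * wnorm r x"
  shows "nuclear_canonical_map germ_scale germs (\<lambda>x. C * wnorm (\<lambda>n. 2 * r n) x) p"
proof -
  let ?r2 = "\<lambda>n. 2 * r n"
  let ?q = "\<lambda>x. C * wnorm ?r2 x"
  have r2: "radii ?r2" by (rule radii_double[OF r])
  have p0: "p x \<ge> 0" if "x \<in> germs" for x using p that by (simp add: continuous_seminorm_def)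
  have "p (germ_scale 0 0) = 0" using p by (simp add: continuous_seminorm_def)
  then have p_zero: "p 0 = 0" by (simp add: germ_scale_def)
  have comp [simp]: "completion_norm p (\<lambda>k. x) = p x" for x
    by (simp add: completion_norm_def)
  have coeff: "norm (fps_nth x n) \<le> 1 / (C * ?r2 n ^ n) * ?q x" if "x \<in> germs" for x n
    using wnorm_coeff[OF r2 that, of n] radii_pos[OF r, of n] C by (simp add: field_simps)
  show ?thesis
    unfolding nuclear_canonical_map_def
  \<comment> \<open>The monomials lie in the space itself, so constant sequences represent them in
    the completion.\<close>
  proof (intro exI[of _ "\<lambda>n x. fps_nth x n"] exI[of _ "\<lambda>n k. fps_X ^ n"] conjI allI ballI)
    show "bounded_functional germ_scale germs ?q (\<lambda>x. fps_nth x n)" for n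
      unfolding bounded_functional_def
      using coeff[of _ n] by (intro conjI exI[of _ "1 / (C * ?r2 n ^ n)"]) auto
    show "(\<lambda>k. fps_X ^ n) \<in> completion_seqs germs p" for n
      by (auto simp: completion_seqs_def p_zero)
    show "summable (\<lambda>n. functional_norm germs ?q (\<lambda>x. fps_nth x n) * completion_norm p (\<lambda>k. fps_X ^ n))"
    proof (rule summable_comparison_test')
      show "summable (\<lambda>n. (1 / 2 :: real) ^ n)" by (rule summable_geometric) simp
      fix n
      let ?F = "functional_norm germs ?q (\<lambda>x. fps_nth x n)"
      have "norm (fps_nth x n) \<le> 1 / (C * ?r2 n ^ n)" if "x \<in> germs" "?q x \<le> 1" for x
      proof -
        have "1 / (C * ?r2 n ^ n) * ?q x \<le> 1 / (C * ?r2 n ^ n) * 1"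
          using that(2) radii_pos[OF r2, of n] C by (intro mult_left_mono) auto
        then show ?thesis using coeff[OF that(1), of n] by simp
      qed
      then have F: "0 \<le> ?F" "?F \<le> 1 / (C * ?r2 n ^ n)"
        using functional_norm_bounds[of germs ?q "\<lambda>x. fps_nth x n" "1 / (C * ?r2 n ^ n)"]
        by (simp_all)
      have "?F * p (fps_X ^ n) \<le> 1 / (C * ?r2 n ^ n) * (C * r n ^ n)"
        using F p0[of "fps_X ^ n"] p_le[of "fps_X ^ n"] C radii_pos[OF r2, of n]
        by (intro mult_mono) (auto simp: wnorm_monomial)
      also have "\<dots> = (1 / 2) ^ n"
        using radii_pos[OF r, of n] C by (simp add: power_mult_distrib power_divide)
      finally show "norm (?F * completion_norm p (\<lambda>k. fps_X ^ n)) \<le> (1 / 2) ^ n"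
        using F(1) p0[of "fps_X ^ n"] by simp
    qed
    fix x :: "complex fps" assume x: "x \<in> germs"
    let ?R = "\<lambda>N. x - (\<Sum>n<N. germ_scale (fps_nth x n) (fps_X ^ n))"
    have R: "?R N \<in> germs" for N
      by (intro germs_diff germs_sum germs_scale germs_closed x)
    have "(\<lambda>N. C * wnorm r (?R N)) \<longlonglongrightarrow> C * 0"
      by (intro tendsto_intros wnorm_remainder_tendsto_0 r x)
    then have lim: "(\<lambda>N. C * wnorm r (?R N)) \<longlonglongrightarrow> 0" by simp
    have "(\<lambda>N. p (?R N)) \<longlonglongrightarrow> 0"
    proof (rule tendsto_sandwich[OF _ _ tendsto_const lim])
      show "eventually (\<lambda>N. 0 \<le> p (?R N)) sequentially"
        using p0[OF R] by (intro always_eventually allI)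
      show "eventually (\<lambda>N. p (?R N) \<le> C * wnorm r (?R N)) sequentially"
        using p_le[OF R] by (intro always_eventually allI)
    qed
    then show "(\<lambda>N. completion_norm p (\<lambda>k. ?R N)) \<longlonglongrightarrow> 0" by simp
  qed
qed

text \<open>A given \<open>p\<close> is dominated by \<open>C * wnorm r\<close>; doubling the radii
  only enlarges the norm, so the resulting seminorm dominates \<open>p\<close> and makes the
  canonical map nuclear.\<close>

lemma nuclear_space_germs: "nuclear_space germ_scale germ_topology"
  unfolding nuclear_space_def topspace_germ_topology
proof (intro conjI allI impI locally_convex_germs)
  fix p assume p: "continuous_seminorm germ_scale germ_topology p"
  obtain r C where r: "radii r" and C: "C > 0" and p_le: "\<And>x. x \<in> germs \<Longrightarrow> p x \<le> C * wnorm r x"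
    using continuous_seminorm_le_wnorm[OF p] by blast
  let ?r2 = "\<lambda>n. 2 * r n"
  have "wnorm r x \<le> wnorm ?r2 x" if x: "x \<in> germs" for x
    unfolding wnorm_def
  proof (rule suminf_le)
    show "r n ^ n * norm (fps_nth x n) \<le> ?r2 n ^ n * norm (fps_nth x n)" for n
      using radii_pos[OF r, of n] by (intro mult_right_mono power_mono) auto
  qed (intro wnorm_summable r x radii_double)+
  then have "p x \<le> C * wnorm ?r2 x" if "x \<in> germs" for x
    using p_le[OF that] C that by (meson mult_left_mono less_imp_le order_trans)
  then show "\<exists>q. continuous_seminorm germ_scale germ_topology q \<and> (\<forall>x\<in>germs. p x \<le> q x) \<and>
      nuclear_canonical_map germ_scale germs q p"
    using continuous_seminorm_wnorm[OF radii_double[OF r] C] nuclear_canonical_map_germs[OF p r C p_le]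
    by blast
qed

theorem corollary4p4:
  shows "topological_algebra germ_scale germ_topology \<and>
    (openin germ_topology germ_units \<and>
     continuous_map (subtopology germ_topology germ_units) germ_topology germ_inverse) \<and>
    (\<forall>f\<in>germs. f \<in> germ_units \<longleftrightarrow> eval_fps f 0 \<noteq> 0) \<and>
    nuclear_space germ_scale germ_topology"
  \<comment> \<open>Evaluation at 0 is the constant coefficient, so \<open>germ_units_iff\<close> is
    the stated criterion for invertibility.\<close>
  using topological_algebra_germs openin_germ_units continuous_map_germ_inverse nuclear_space_germs
  by (simp add: germ_units_iff eval_fps_at_0)

end
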